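(* Suppose each $f_i$ ($1\le i\le n$) has $L_i$-Lipschitz continuous gradient and is $\mu_i$-strongly convex, let $L=\max_iL_i$, and let the steplength satisfy $0<\alpha\le\min\{\frac1L,c_4\}$, where $c_4=\frac{2}{\mu_{\bar f}+L_{\bar f}}$. Let $t_c(k)=k$ and $t_g(k)=\max\{t_g(0)-k,1\}$, where $t_g(k)\in\mathbb{Z}_+$ (positive integers). Then the iterates generated by the NEAR-DGD$^{t_c(k),t_g(k)}$ method converge at an R-linear rate to the solution, namely $$\|\bar x_k-x^\star\|\le C\rho^k\qquad\text{for all }k=0,1,2,\ldots,$$ where $$C=\max\left\{\|\bar x_0-x^\star\|,\ \frac{8(\hat c_3+\hat c_5)}{(\alpha c_2)^2}\right\},\qquad \rho=\max\left\{\beta,\ \tau,\ 1-\frac{\alpha c_2}{2}\right\},$$ $$\tau=\max_{i=0,\dots,t_g(0)-1}\left\{\frac{T_{i+1}}{T_i}\right\},\qquad T_k=\eta^{t_g(k)}-1-t_g(k)(\eta-1),$$ $$\hat c_3=c_3(\eta^{t_g(0)}-1),\qquad \hat c_5=c_5T_0,$$ with the convention $0/0=0$ in the definition of $\tau$, and $$c_2=\frac{2\mu_{\bar f}L_{\bar f}}{\mu_{\bar f}+L_{\bar f}},\quad c_3=\frac{\alpha DL}{\eta-1},\quad c_5=\frac{\alpha M}{\eta-1},\quad \eta=1+\alpha L.$$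
   Context: Setting. $f_1,\dots,f_n:\mathbb{R}^p\to\mathbb{R}$ are convex differentiable functions; $L_i,\mu_i>0$ denote the Lipschitz constant of $\nabla f_i$ and the strong convexity constant of $f_i$. Norms are Euclidean (spectral for matrices). $\mathbf{W}\in\mathbb{R}^{n\times n}$ is the consensus matrix of a connected undirected graph on $\{1,\dots,n\}$: symmetric, doubly stochastic, $w_{ii}>0$, and for $i\ne j$, $w_{ij}>0$ if and only if $i,j$ are neighbors. It has exactly one eigenvalue equal to $1$, the others having absolute value strictly less than $1$; $\beta$, with $0<\beta<1$, is the second largest, in magnitude, eigenvalue of $\mathbf{W}$ (its absolute value). $\mathbf{Z}=\mathbf{W}\otimes I_p$. Method NEAR-DGD$^{t_c(k),t_g(k)}$ with constant steplength $\alpha>0$. A vector in $\mathbb{R}^{np}$ is written as a concatenation of $n$ blocks in $\mathbb{R}^p$, e.g. $\mathbf{x}_k=[x_{1,k};\dots;x_{n,k}]$, and $\nabla\mathbf{f}(\mathbf{x})=[\nabla f_1(x_1);\dots;\nabla f_n(x_n)]$. Initialize $x_{i,0}=s_0$ for all $i$, with $s_0\in\mathbb{R}^p$ arbitrary. For $k\ge0$: $\mathbf{x}_k^0=\mathbf{x}_k$, $\mathbf{x}_k^j=\mathbf{x}_k^{j-1}-\alpha\nabla\mathbf{f}(\mathbf{x}_k^{j-1})$ for $j=1,\dots,t_g(k)$, $\mathbf{y}_k=\mathbf{x}_k^{t_g(k)}$, and $\mathbf{x}_{k+1}=\mathbf{Z}^{t_c(k)}\mathbf{y}_k$ ($\mathbf{Z}^0$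 is the identity). Average: $\bar x_k=\frac1n\sum_{i=1}^n x_{i,k}$. Constants. $x^\star\in\mathbb{R}^p$ is the minimizer of $\sum_{i=1}^n f_i$ over $\mathbb{R}^p$. $\bar f=\frac1n\sum_i f_i$, $\mu_{\bar f}=\frac1n\sum_i\mu_i$, $L_{\bar f}=\frac1n\sum_i L_i$. $u_i^\star=\arg\min_u f_i(u)$, $\mathbf{u}^\star=[u_1^\star;\dots;u_n^\star]$, $\gamma_i=\frac{\mu_iL_i}{\mu_i+L_i}$, $\gamma=\min_i\gamma_i$, $\nu=2\alpha\gamma$, $D=\|\mathbf{y}_0-\mathbf{u}^\star\|+\frac{\nu+4}{\nu}\|\mathbf{u}^\star\|$, $\widehat D=\|x^\star\|+\frac{D}{\sqrt n}$, $M=2L\widehat D+\sum_{i=1}^n\|\nabla f_i(x^\star)\|$. *)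

theory Defs
  imports "HOL-Analysis.Analysis"
begin

subsection \<open>Strong convexity\<close>

definition strongly_convex :: "real \<Rightarrow> ('a::real_inner \<Rightarrow> real) \<Rightarrow> bool" where
  "strongly_convex \<mu> f \<longleftrightarrow>
     (\<forall>x y t. 0 \<le> t \<and> t \<le> 1 \<longrightarrow>
        f ((1 - t) *\<^sub>R x + t *\<^sub>R y)
          \<le> (1 - t) * f x + t * f y - \<mu> / 2 * (t * (1 - t)) * (norm (x - y))\<^sup>2)"

subsection \<open>Block vectors and matrices\<close>

text \<open>
  A vector of \<open>n\<close> blocks of length \<open>p\<close> is indexed by pairs (block, position in the block),
  so its norm is the Euclidean norm of the concatenation.
\<close>

definition stack :: "('n::finite \<Rightarrow> real ^ 'p::finite) \<Rightarrow> real ^ ('n \<times> 'p)" where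
  "stack v = (\<chi> r. v (fst r) $ snd r)"

definition block :: "real ^ ('n::finite \<times> 'p::finite) \<Rightarrow> 'n \<Rightarrow> real ^ 'p" where
  "block x i = (\<chi> q. x $ (i, q))"

definition block_average :: "real ^ ('n::finite \<times> 'p::finite) \<Rightarrow> real ^ 'p" where
  "block_average x = (1 / real CARD('n)) *\<^sub>R (\<Sum>i\<in>UNIV. block x i)"

definition kronecker ::
    "real ^ 'b::finite ^ 'a::finite \<Rightarrow> real ^ 'd::finite ^ 'c::finite \<Rightarrow>
     real ^ ('b \<times> 'd) ^ ('a \<times> 'c)" where
  "kronecker A B = (\<chi> r s. A $ fst r $ fst s * B $ snd r $ snd s)"

text \<open>The library's power operation on this type is entrywise; this is the matrix power.\<close>

primrec matrix_power :: "real ^ 'm::finite ^ 'm \<Rightarrow> nat \<Rightarrow> real ^ 'm ^ 'm" where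
  "matrix_power A 0 = mat 1"
| "matrix_power A (Suc k) = A ** matrix_power A k"

subsection \<open>Consensus matrices\<close>

definition connected_graph :: "('n \<times> 'n) set \<Rightarrow> bool" where
  "connected_graph E \<longleftrightarrow> sym E \<and> irrefl E \<and> (\<forall>i j. (i, j) \<in> E\<^sup>*)"

definition doubly_stochastic :: "real ^ 'n::finite ^ 'n \<Rightarrow> bool" where
  "doubly_stochastic W \<longleftrightarrow>
     (\<forall>i j. 0 \<le> W $ i $ j) \<and>
     (\<forall>i. (\<Sum>j\<in>UNIV. W $ i $ j) = 1) \<and> (\<forall>j. (\<Sum>i\<in>UNIV. W $ i $ j) = 1)"

definition consensus_matrix :: "('n::finite \<times> 'n) set \<Rightarrow> real ^ 'n ^ 'n \<Rightarrow> bool" where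
  "consensus_matrix E W \<longleftrightarrow>
     transpose W = W \<and> doubly_stochastic W \<and> (\<forall>i. 0 < W $ i $ i) \<and>
     (\<forall>i j. i \<noteq> j \<longrightarrow> (0 < W $ i $ j \<longleftrightarrow> (i, j) \<in> E))"

text \<open>Real eigenvalues suffice here: the matrices considered are symmetric.\<close>

definition eigenvalue :: "real ^ 'n::finite ^ 'n \<Rightarrow> real \<Rightarrow> bool" where
  "eigenvalue A l \<longleftrightarrow> (\<exists>v. v \<noteq> 0 \<and> A *v v = l *\<^sub>R v)"

text \<open>
  The eigenvalue 1 of a consensus matrix of a connected graph is simple and strictly dominant
  (\<open>consensus_eigenvector_const\<close>, \<open>consensus_eigenvalue_less_1\<close> below), so the second
  largest eigenvalue in magnitude is the largest one in magnitude among those different from 1.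
  The predicate is unsatisfiable for one agent, where there is no second eigenvalue.
\<close>

definition second_largest_abs_eigenvalue :: "real ^ 'n::finite ^ 'n \<Rightarrow> real \<Rightarrow> bool" where
  "second_largest_abs_eigenvalue W \<beta> \<longleftrightarrow>
     (\<exists>l. eigenvalue W l \<and> l \<noteq> 1 \<and> \<beta> = \<bar>l\<bar>) \<and>
     (\<forall>l. eigenvalue W l \<and> l \<noteq> 1 \<longrightarrow> \<bar>l\<bar> \<le> \<beta>)"

lemma consensus_eigenvalue_1:
  assumes "consensus_matrix E W"
  shows "eigenvalue W 1"
proof -
  have "W *v (vec 1) = 1 *\<^sub>R vec 1"
    using assms by (simp add: consensus_matrix_def doubly_stochastic_def
        matrix_vector_mult_def vec_eq_iff)
  moreover have "(vec 1 :: real ^ 'a) \<noteq> 0"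
    by (simp add: vec_eq_iff)
  ultimately show ?thesis unfolding eigenvalue_def by blast
qed

lemma consensus_eigenvector_const:
  assumes "connected_graph E" and W: "consensus_matrix E W" and v: "W *v v = v"
  shows "v $ i = v $ j"
proof -
  define m where "m = Max (range (\<lambda>i. v $ i))"
  have le: "v $ i \<le> m" for i
    by (simp add: m_def)
  have "m \<in> range (\<lambda>i. v $ i)"
    unfolding m_def by (rule Max_in) auto
  then obtain a where a: "v $ a = m"
    by auto
  have nn: "0 \<le> W $ i $ j" and row: "(\<Sum>j\<in>UNIV. W $ i $ j) = 1" for i j
    using W by (auto simp: consensus_matrix_def doubly_stochastic_def)
  have step: "v $ c = m" if "v $ b = m" "(b, c) \<in> E" for b c
  proof -
    have "b \<noteq> c" using that assms(1) by (auto simp: connected_graph_def irrefl_def)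
    then have pos: "0 < W $ b $ c" using that W by (auto simp: consensus_matrix_def)
    have "(\<Sum>k\<in>UNIV. W $ b $ k * v $ k) = m"
      using arg_cong[OF v, of "\<lambda>x. x $ b"] that(1) by (simp add: matrix_vector_mult_def)
    moreover have "(\<Sum>k\<in>UNIV. W $ b $ k * m) = m"
      using row by (simp flip: sum_distrib_right)
    ultimately have "(\<Sum>k\<in>UNIV. W $ b $ k * (m - v $ k)) = 0"
      by (simp add: right_diff_distrib sum_subtractf)
    then have "\<forall>k\<in>UNIV. W $ b $ k * (m - v $ k) = 0"
      using nn le by (subst (asm) sum_nonneg_eq_0_iff) auto
    then show ?thesis using pos by (metis UNIV_I eq_iff_diff_eq_0 less_irrefl mult_eq_0_iff)
  qed
  have "v $ i = m" for i
  proof -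
    have "(a, i) \<in> E\<^sup>*" using assms(1) by (simp add: connected_graph_def)
    then show ?thesis by (induction rule: rtrancl_induct) (use a step in blast)+
  qed
  then show ?thesis by simp
qed

lemma consensus_eigenvalue_less_1:
  assumes W: "consensus_matrix E W" and "eigenvalue W l" and "l \<noteq> 1"
  shows "\<bar>l\<bar> < 1"
proof -
  obtain v where v0: "v \<noteq> 0" and v: "W *v v = l *\<^sub>R v"
    using assms(2) by (auto simp: eigenvalue_def)
  define m where "m = Max (range (\<lambda>i. \<bar>v $ i\<bar>))"
  have le: "\<bar>v $ i\<bar> \<le> m" for i
    by (simp add: m_def)
  have "m \<in> range (\<lambda>i. \<bar>v $ i\<bar>)"
    unfolding m_def by (rule Max_in) auto
  then obtain a where a: "\<bar>v $ a\<bar> = m"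
    by auto
  obtain b where "v $ b \<noteq> 0" using v0 by (auto simp: vec_eq_iff)
  then have m: "0 < m" using le[of b] by linarith
  have nn: "0 \<le> W $ i $ j" and row: "(\<Sum>j\<in>UNIV. W $ i $ j) = 1" for i j
    using W by (auto simp: consensus_matrix_def doubly_stochastic_def)
  have pos: "0 < W $ a $ a" using W by (simp add: consensus_matrix_def)
  have eq: "(\<Sum>k\<in>UNIV. W $ a $ k * v $ k) = l * v $ a"
    using arg_cong[OF v, of "\<lambda>x. x $ a"] by (simp add: matrix_vector_mult_def)
  have "(\<Sum>k\<in>UNIV. W $ a $ k * v $ k)
      = W $ a $ a * v $ a + (\<Sum>k\<in>UNIV - {a}. W $ a $ k * v $ k)"
    by (simp add: sum.remove)
  then have "\<bar>(l - W $ a $ a) * v $ a\<bar> = \<bar>\<Sum>k\<in>UNIV - {a}. W $ a $ k * v $ k\<bar>"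
    using eq by (simp add: algebra_simps)
  also have "\<dots> \<le> (\<Sum>k\<in>UNIV - {a}. \<bar>W $ a $ k * v $ k\<bar>)"
    by (rule sum_abs)
  also have "\<dots> \<le> (\<Sum>k\<in>UNIV - {a}. W $ a $ k * m)"
    using nn le by (intro sum_mono) (auto simp: abs_mult intro: mult_left_mono)
  also have "\<dots> = (\<Sum>k\<in>UNIV - {a}. W $ a $ k) * m"
    by (simp add: sum_distrib_right)
  also have "\<dots> = (1 - W $ a $ a) * m"
    using row[of a] by (simp add: sum.remove[of UNIV a])
  finally have "\<bar>l - W $ a $ a\<bar> * m \<le> (1 - W $ a $ a) * m"
    by (simp add: abs_mult a)
  then have "\<bar>l - W $ a $ a\<bar> \<le> 1 - W $ a $ a"
    using m by simp
  then show ?thesis using pos assms(3) by linarith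
qed

subsection \<open>The NEAR-DGD method\<close>

definition stacked_gradient ::
    "('n::finite \<Rightarrow> real ^ 'p::finite \<Rightarrow> real ^ 'p) \<Rightarrow> real ^ ('n \<times> 'p) \<Rightarrow> real ^ ('n \<times> 'p)" where
  "stacked_gradient g x = stack (\<lambda>i. g i (block x i))"

definition gradient_step ::
    "real \<Rightarrow> ('n::finite \<Rightarrow> real ^ 'p::finite \<Rightarrow> real ^ 'p) \<Rightarrow> real ^ ('n \<times> 'p) \<Rightarrow> real ^ ('n \<times> 'p)"
    where
  "gradient_step \<alpha> g x = x - \<alpha> *\<^sub>R stacked_gradient g x"

primrec near_dgd ::
    "real ^ 'n::finite ^ 'n \<Rightarrow> ('n \<Rightarrow> real ^ 'p::finite \<Rightarrow> real ^ 'p) \<Rightarrow> real \<Rightarrow>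
     (nat \<Rightarrow> nat) \<Rightarrow> (nat \<Rightarrow> nat) \<Rightarrow> real ^ 'p \<Rightarrow> nat \<Rightarrow> real ^ ('n \<times> 'p)" where
  "near_dgd W g \<alpha> tc tg s0 0 = stack (\<lambda>_. s0)"
| "near_dgd W g \<alpha> tc tg s0 (Suc k) =
     matrix_power (kronecker W (mat 1)) (tc k) *v
       (gradient_step \<alpha> g ^^ tg k) (near_dgd W g \<alpha> tc tg s0 k)"

end

theory Submission
  imports Defs
begin

text \<open>
  During the inner loop, compare the local gradient iterates with the iterates of gradient
  descent on the average function, started from the current average. The comparison iterates
  contract towards \<open>xstar\<close> by the factor \<open>sqrt (1 - s)\<close> with \<open>s = \<alpha> c2\<close>. The averages of the local
  iterates deviate from them by two terms: the disagreement before the loop, amplified by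
  \<open>\<eta> ^ t - 1\<close>, and the heterogeneity of the local gradients, amplified by \<open>\<eta> ^ t - 1 - t (\<eta> - 1)\<close>.
  Both decay geometrically in \<open>k\<close>: consensus contracts the disagreement by \<open>\<beta>\<close> per
  multiplication while the \<open>y k\<close> stay bounded by \<open>D\<close>, and the number of gradient steps decreases
  to 1. Since \<open>sqrt (1 - s)\<close> lies below \<open>1 - s / 2\<close> by at least \<open>s\<^sup>2 / 8\<close>, the perturbed contraction
  converges at the rate \<open>\<rho>\<close>.
\<close>

section \<open>Gradient steps for smooth strongly convex functions\<close>

text \<open>Both inequalities are linear in the data \<open>m\<close>, \<open>L\<close>,
  \<open>f\<close>, \<open>g\<close>, so averages of functions inherit them with averaged constants.
  The local objectives and their mean can then share the same contraction lemma.\<close>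

definition quadratic_sandwich ::
    "real \<Rightarrow> real \<Rightarrow> ('a::real_inner \<Rightarrow> real) \<Rightarrow> ('a \<Rightarrow> 'a) \<Rightarrow> bool" where
  "quadratic_sandwich m L f g \<longleftrightarrow>
     (\<forall>x y. f x + g x \<bullet> (y - x) + m / 2 * (norm (y - x))\<^sup>2 \<le> f y \<and>
            f y \<le> f x + g x \<bullet> (y - x) + L / 2 * (norm (y - x))\<^sup>2)"

lemma GDERIV_along_line:
  assumes "GDERIV f (x + t *\<^sub>R w) :> g"
  shows "((\<lambda>t. f (x + t *\<^sub>R w)) has_real_derivative g \<bullet> w) (at t)"
proof -
  have 1: "(f has_derivative (\<lambda>h. h \<bullet> g)) (at (x + t *\<^sub>R w))"
    using assms by (simp add: gderiv_def)
  have 2: "((\<lambda>t. x + t *\<^sub>R w) has_derivative (\<lambda>h. h *\<^sub>R w)) (at t)"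
    by (auto intro!: derivative_eq_intros)
  have "((\<lambda>t. f (x + t *\<^sub>R w)) has_derivative (\<lambda>h. (h *\<^sub>R w) \<bullet> g)) (at t)"
    using has_derivative_compose[OF 2, of f "\<lambda>h. h \<bullet> g"] 1 by simp
  then show ?thesis
    by (rule has_derivative_imp_has_field_derivative) (simp add: inner_commute)
qed

text \<open>Strong convexity on the segment from \<open>x\<close> to \<open>y\<close>, divided by
  the step length \<open>h\<close>, bounds a difference quotient; the claim is its limit as
  \<open>h\<close> decreases to 0.\<close>

lemma strongly_convex_lower_bound:
  assumes sc: "strongly_convex m f" and d: "GDERIV f x :> g"
  shows "f x + g \<bullet> (y - x) + m / 2 * (norm (y - x))\<^sup>2 \<le> f y"
proof -
  define w where "w = y - x"
  have "((\<lambda>t. f (x + t *\<^sub>R w)) has_real_derivative g \<bullet> w) (at 0)"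
    by (rule GDERIV_along_line) (use d in simp)
  then have "((\<lambda>h. (f (x + h *\<^sub>R w) - f x) / h) \<longlongrightarrow> g \<bullet> w) (at_right 0)"
    by (auto simp: DERIV_def intro: filterlim_mono at_le)
  moreover have "((\<lambda>h. f y - f x - m / 2 * (1 - h) * (norm w)\<^sup>2)
      \<longlongrightarrow> f y - f x - m / 2 * (1 - 0) * (norm w)\<^sup>2) (at_right 0)"
    by (intro tendsto_intros)
  moreover have "\<forall>\<^sub>F h in at_right 0.
      (f (x + h *\<^sub>R w) - f x) / h \<le> f y - f x - m / 2 * (1 - h) * (norm w)\<^sup>2"
    unfolding eventually_at_right_field
  proof (intro exI[of _ 1] conjI allI impI)
    fix h :: real assume h: "0 < h" "h < 1"
    have "f ((1 - h) *\<^sub>R x + h *\<^sub>R y)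
        \<le> (1 - h) * f x + h * f y - m / 2 * (h * (1 - h)) * (norm (x - y))\<^sup>2"
      using sc h unfolding strongly_convex_def by auto
    moreover have "(1 - h) *\<^sub>R x + h *\<^sub>R y = x + h *\<^sub>R w"
      by (simp add: w_def algebra_simps)
    ultimately have "f (x + h *\<^sub>R w) - f x
        \<le> h * (f y - f x - m / 2 * (1 - h) * (norm w)\<^sup>2)"
      by (simp add: w_def norm_minus_commute algebra_simps)
    then show "(f (x + h *\<^sub>R w) - f x) / h \<le> f y - f x - m / 2 * (1 - h) * (norm w)\<^sup>2"
      using h by (simp add: divide_le_eq mult.commute)
  qed simp
  ultimately have "g \<bullet> w \<le> f y - f x - m / 2 * (1 - 0) * (norm w)\<^sup>2"
    by (intro tendsto_le[OF trivial_limit_at_right_real])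
  then show ?thesis by (simp add: w_def)
qed

lemma lipschitz_gradient_upper_bound:
  assumes d: "\<And>z. GDERIV f z :> g z" and lip: "L-lipschitz_on UNIV g"
  shows "f y \<le> f x + g x \<bullet> (y - x) + L / 2 * (norm (y - x))\<^sup>2"
proof -
  define w where "w = y - x"
  \<comment> \<open>\<open>\<phi>\<close> is \<open>f\<close> along the segment minus its quadratic
    upper model, up to the constant \<open>f x\<close>. Cauchy-Schwarz and the Lipschitz bound make
    its derivative nonpositive.\<close>
  define \<phi> where "\<phi> t = f (x + t *\<^sub>R w) - t * (g x \<bullet> w) - L / 2 * t\<^sup>2 * (norm w)\<^sup>2" for t
  have "\<phi> 1 \<le> \<phi> 0"
  proof (rule DERIV_nonpos_imp_nonincreasing[where f = \<phi>])
    fix t :: real assume t: "0 \<le> t" "t \<le> 1"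
    have "(\<phi> has_real_derivative
        g (x + t *\<^sub>R w) \<bullet> w - g x \<bullet> w - L * t * (norm w)\<^sup>2) (at t)"
      unfolding \<phi>_def
      by (rule derivative_eq_intros GDERIV_along_line d refl | simp)+
    moreover have "g (x + t *\<^sub>R w) \<bullet> w - g x \<bullet> w - L * t * (norm w)\<^sup>2 \<le> 0"
    proof -
      have "g (x + t *\<^sub>R w) \<bullet> w - g x \<bullet> w \<le> norm (g (x + t *\<^sub>R w) - g x) * norm w"
        using norm_cauchy_schwarz[of "g (x + t *\<^sub>R w) - g x" w] by (simp add: inner_diff_left)
      also have "\<dots> \<le> (L * (t * norm w)) * norm w"
        using lipschitz_onD[OF lip, of "x + t *\<^sub>R w" x] t
        by (intro mult_right_mono) (auto simp: dist_norm)
      finally show ?thesis by (simp add: power2_eq_square mult.assoc)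
    qed
    ultimately show "\<exists>l. DERIV \<phi> t :> l \<and> l \<le> 0" by blast
  qed simp
  then show ?thesis by (simp add: \<phi>_def w_def)
qed

lemma quadratic_sandwichI:
  assumes "strongly_convex m f" "\<And>z. GDERIV f z :> g z" "L-lipschitz_on UNIV g"
  shows "quadratic_sandwich m L f g"
  using strongly_convex_lower_bound[OF assms(1,2)] lipschitz_gradient_upper_bound[OF assms(2,3)]
  unfolding quadratic_sandwich_def by blast

text \<open>A Euclidean space contains a unit vector; at distance 1 the lower and upper models
  differ exactly by \<open>(L - m) / 2\<close>.\<close>

lemma quadratic_sandwich_mono:
  fixes f :: "'a::euclidean_space \<Rightarrow> real"
  assumes "quadratic_sandwich m L f g"
  shows "m \<le> L"
proof -
  obtain b :: 'a where "b \<in> Basis" by (meson ex_in_conv nonempty_Basis)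
  then have "norm (b - 0) = 1" by simp
  then show ?thesis
    using assms unfolding quadratic_sandwich_def
    by (smt (verit, best) mult_cancel_left1 power_one divide_right_mono field_sum_of_halves)
qed

lemma quadratic_sandwich_gradient_zero:
  assumes s: "quadratic_sandwich m L f g" and "0 < L" and min: "is_arg_min f (\<lambda>_. True) x"
  shows "g x = 0"
proof -
  \<comment> \<open>A gradient step of length \<open>1 / L\<close> minimises the upper model at
    \<open>x\<close> and would lower \<open>f\<close> by at least
    \<open>(norm (g x))\<^sup>2 / (2 * L)\<close>.\<close>
  define y where "y = x - (1 / L) *\<^sub>R g x"
  have "f x \<le> f y" using min by (auto simp: is_arg_min_def not_less)
  also have "f y \<le> f x + g x \<bullet> (y - x) + L / 2 * (norm (y - x))\<^sup>2"
    using s by (simp add: quadratic_sandwich_def)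
  also have "\<dots> = f x - (norm (g x))\<^sup>2 / (2 * L)"
    using \<open>0 < L\<close> unfolding y_def power2_norm_eq_inner by (simp add: field_simps)
  finally have "(norm (g x))\<^sup>2 \<le> 0" using \<open>0 < L\<close> by (simp add: divide_le_0_iff)
  then show ?thesis by simp
qed

lemma quadratic_sandwich_average:
  fixes f :: "'i::finite \<Rightarrow> 'a::real_inner \<Rightarrow> real"
  assumes "\<And>i. quadratic_sandwich (m i) (L i) (f i) (g i)" and "0 \<le> c"
  shows "quadratic_sandwich (c * (\<Sum>i\<in>UNIV. m i)) (c * (\<Sum>i\<in>UNIV. L i))
    (\<lambda>z. c * (\<Sum>i\<in>UNIV. f i z)) (\<lambda>z. c *\<^sub>R (\<Sum>i\<in>UNIV. g i z))"
  unfolding quadratic_sandwich_def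
proof (intro allI conjI)
  fix x y :: 'a
  have "(\<Sum>i\<in>UNIV. f i x + g i x \<bullet> (y - x) + m i / 2 * (norm (y - x))\<^sup>2) \<le> (\<Sum>i\<in>UNIV. f i y)"
    using assms(1) by (intro sum_mono) (simp add: quadratic_sandwich_def)
  from mult_left_mono[OF this \<open>0 \<le> c\<close>]
  show "c * (\<Sum>i\<in>UNIV. f i x) + (c *\<^sub>R (\<Sum>i\<in>UNIV. g i x)) \<bullet> (y - x)
      + (c * (\<Sum>i\<in>UNIV. m i)) / 2 * (norm (y - x))\<^sup>2 \<le> c * (\<Sum>i\<in>UNIV. f i y)"
    by (simp add: sum.distrib inner_sum_left sum_distrib_right[symmetric]
        sum_divide_distrib[symmetric] ring_distribs mult.assoc)
  have "(\<Sum>i\<in>UNIV. f i y) \<le> (\<Sum>i\<in>UNIV. f i x + g i x \<bullet> (y - x) + L i / 2 * (norm (y - x))\<^sup>2)"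
    using assms(1) by (intro sum_mono) (simp add: quadratic_sandwich_def)
  from mult_left_mono[OF this \<open>0 \<le> c\<close>]
  show "c * (\<Sum>i\<in>UNIV. f i y) \<le> c * (\<Sum>i\<in>UNIV. f i x) + (c *\<^sub>R (\<Sum>i\<in>UNIV. g i x)) \<bullet> (y - x)
      + (c * (\<Sum>i\<in>UNIV. L i)) / 2 * (norm (y - x))\<^sup>2"
    by (simp add: sum.distrib inner_sum_left sum_distrib_right[symmetric]
        sum_divide_distrib[symmetric] ring_distribs mult.assoc)
qed

lemma quadratic_sandwich_coercive:
  fixes f :: "'a::euclidean_space \<Rightarrow> real"
  assumes s: "quadratic_sandwich m L f g"
  shows "m * L * (norm (x - y))\<^sup>2 + (norm (g x - g y))\<^sup>2 \<le> (m + L) * ((g x - g y) \<bullet> (x - y))"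
proof -
  text \<open>With \<open>h = f - m/2 |.|\<^sup>2\<close>, convex with quadratic upper bound of curvature \<open>L - m\<close>,
    compare the lower model of \<open>h\<close> at \<open>x\<close> and the upper model at \<open>y\<close> in the point \<open>y - c d\<close>,
    where \<open>d\<close> is the difference of the gradients of \<open>h\<close>.\<close>
  have key: "(2 * c - (L - m) * c\<^sup>2) / 2 * (norm d)\<^sup>2
      \<le> f y - f x - g x \<bullet> (y - x) - m / 2 * (norm (y - x))\<^sup>2"
    if d: "d = (g y - g x) - m *\<^sub>R (y - x)" for x y d :: 'a and c :: real
  proof -
    define z where "z = y - c *\<^sub>R d"
    have "f x + g x \<bullet> (z - x) + m / 2 * (norm (z - x))\<^sup>2 \<le> f z"
      and "f z \<le> f y + g y \<bullet> (z - y) + L / 2 * (norm (z - y))\<^sup>2"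
      using s by (auto simp: quadratic_sandwich_def)
    then have *: "f x + g x \<bullet> (z - x) + m / 2 * (norm (z - x))\<^sup>2
        \<le> f y + g y \<bullet> (z - y) + L / 2 * (norm (z - y))\<^sup>2" by linarith
    define w where "w = y - x"
    have gy: "g y = d + g x + m *\<^sub>R w" by (simp add: d w_def)
    have zx: "z - x = w - c *\<^sub>R d" and zy: "z - y = - (c *\<^sub>R d)" by (simp_all add: z_def w_def)
    from * show ?thesis
      unfolding gy zx zy w_def[symmetric] power2_norm_eq_inner
      by (simp add: inner_simps inner_commute field_simps power2_eq_square)
  qed
  define w where "w = x - y"
  define G where "G = g x - g y"
  define d where "d = G - m *\<^sub>R w"
  \<comment> \<open>Adding \<open>key\<close> for both orders of the two points cancels the function
    values; the swap turns \<open>d\<close> into \<open>- d\<close>, which leaves its norm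
    unchanged.\<close>
  have c: "(2 * c - (L - m) * c\<^sup>2) * (norm d)\<^sup>2 \<le> d \<bullet> w" for c
  proof -
    have "(2 * c - (L - m) * c\<^sup>2) / 2 * (norm d)\<^sup>2
        \<le> f x - f y - g y \<bullet> (x - y) - m / 2 * (norm (x - y))\<^sup>2"
      by (rule key) (simp add: d_def G_def w_def)
    moreover have "(2 * c - (L - m) * c\<^sup>2) / 2 * (norm (- d))\<^sup>2
        \<le> f y - f x - g x \<bullet> (y - x) - m / 2 * (norm (y - x))\<^sup>2"
      by (rule key) (simp add: d_def G_def w_def algebra_simps)
    ultimately have "(2 * c - (L - m) * c\<^sup>2) * (norm d)\<^sup>2
        \<le> - g y \<bullet> (x - y) - g x \<bullet> (y - x) - m / 2 * (norm (x - y))\<^sup>2 - m / 2 * (norm (y - x))\<^sup>2"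
      by (simp add: field_simps)
    also have "\<dots> = d \<bullet> w"
      by (simp add: d_def G_def w_def power2_norm_eq_inner inner_simps inner_commute algebra_simps)
    finally show ?thesis .
  qed
  have "(norm d)\<^sup>2 \<le> (L - m) * (d \<bullet> w)"
  proof (cases "L = m")
    case False
    then have pos: "0 < L - m" using quadratic_sandwich_mono[OF s] by simp
    \<comment> \<open>\<open>c = 1 / (L - m)\<close> maximises the coefficient
      \<open>2 * c - (L - m) * c\<^sup>2\<close>.\<close>
    then have "2 * (1 / (L - m)) - (L - m) * (1 / (L - m))\<^sup>2 = 1 / (L - m)"
      by (simp add: power2_eq_square)
    then show ?thesis
      using c[of "1 / (L - m)"] pos by (simp add: divide_le_eq mult.commute)
  next
    case True
    \<comment> \<open>With \<open>L = m\<close> the coefficient is \<open>2 * c\<close>, which is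
      unbounded in \<open>c\<close>, so \<open>d\<close> must vanish.\<close>
    have "(norm d)\<^sup>2 \<le> 0"
    proof (rule ccontr)
      assume "\<not> (norm d)\<^sup>2 \<le> 0"
      then have "0 < (norm d)\<^sup>2" by simp
      then show False using c[of "(d \<bullet> w + 1) / (2 * (norm d)\<^sup>2)"] True by simp
    qed
    then show ?thesis using True by simp
  qed
  then have "m * L * (norm w)\<^sup>2 + (norm G)\<^sup>2 \<le> (m + L) * (G \<bullet> w)"
    by (simp add: d_def power2_norm_eq_inner inner_simps inner_commute algebra_simps)
  then show ?thesis by (simp add: w_def G_def)
qed

text \<open>Expand the square and replace the inner product by the coercivity bound. The gradient
  difference is left with the coefficient \<open>\<alpha> * (\<alpha> - 2 / (m + L))\<close>, which
  the step length bound makes nonpositive.\<close>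

lemma gradient_step_contraction:
  fixes f :: "'a::euclidean_space \<Rightarrow> real"
  assumes s: "quadratic_sandwich m L f g" and pos: "0 < m" "0 < L"
    and \<alpha>: "0 \<le> \<alpha>" "\<alpha> \<le> 2 / (m + L)"
  shows "(norm ((x - \<alpha> *\<^sub>R g x) - (y - \<alpha> *\<^sub>R g y)))\<^sup>2
    \<le> (1 - \<alpha> * (2 * m * L / (m + L))) * (norm (x - y))\<^sup>2"
proof -
  define w where "w = x - y"
  define G where "G = g x - g y"
  have "m * L * (norm w)\<^sup>2 + (norm G)\<^sup>2 \<le> (m + L) * (G \<bullet> w)"
    using quadratic_sandwich_coercive[OF s, of x y] by (simp add: w_def G_def)
  then have "2 * \<alpha> * ((m * L * (norm w)\<^sup>2 + (norm G)\<^sup>2) / (m + L)) \<le> 2 * \<alpha> * (G \<bullet> w)"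
    using pos \<alpha> by (intro mult_left_mono) (auto simp: divide_le_eq mult.commute)
  from diff_left_mono[OF this, of "(norm w)\<^sup>2"]
  have "(norm w)\<^sup>2 - 2 * \<alpha> * (G \<bullet> w)
      \<le> (norm w)\<^sup>2 - 2 * \<alpha> * ((m * L * (norm w)\<^sup>2 + (norm G)\<^sup>2) / (m + L))" .
  moreover have "\<alpha> * (\<alpha> * (norm G)\<^sup>2) \<le> \<alpha> * (2 / (m + L) * (norm G)\<^sup>2)"
    using \<alpha> by (intro mult_left_mono mult_right_mono) auto
  moreover have "(norm (w - \<alpha> *\<^sub>R G))\<^sup>2
      = (norm w)\<^sup>2 - 2 * \<alpha> * (G \<bullet> w) + \<alpha> * (\<alpha> * (norm G)\<^sup>2)"
    by (simp add: power2_norm_eq_inner inner_simps inner_commute algebra_simps)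
  ultimately have "(norm (w - \<alpha> *\<^sub>R G))\<^sup>2
      \<le> (norm w)\<^sup>2 - 2 * \<alpha> * ((m * L * (norm w)\<^sup>2 + (norm G)\<^sup>2) / (m + L))
        + \<alpha> * (2 / (m + L) * (norm G)\<^sup>2)"
    by (simp only: add_mono)
  also have "\<dots> = (1 - \<alpha> * (2 * m * L / (m + L))) * (norm w)\<^sup>2"
    by (simp add: add_divide_distrib algebra_simps)
  finally show ?thesis by (simp add: w_def G_def algebra_simps)
qed

section \<open>Self-adjoint operators\<close>

text \<open>A variational substitute for diagonalisation: a unit vector \<open>v\<close> of
  \<open>S\<close> maximising \<open>norm (A v)\<close> satisfies
  \<open>A (A v) = m\<^sup>2 *\<^sub>R v\<close>, which yields an eigenvector for \<open>m\<close>
  or \<open>- m\<close>. The subspace \<open>S\<close> allows restriction to block vectors with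
  average zero.\<close>

lemma selfadjoint_norm_le_eigenvalue_bound:
  fixes A :: "'a::euclidean_space \<Rightarrow> 'a"
  assumes lin: "linear A" and sa: "\<And>x y. A x \<bullet> y = x \<bullet> A y"
    and S: "subspace S" and inv: "\<And>x. x \<in> S \<Longrightarrow> A x \<in> S"
    and ev: "\<And>v l. v \<in> S \<Longrightarrow> v \<noteq> 0 \<Longrightarrow> A v = l *\<^sub>R v \<Longrightarrow> \<bar>l\<bar> \<le> b"
    and x: "x \<in> S"
  shows "norm (A x) \<le> b * norm x"
proof (cases "x = 0")
  case True
  then show ?thesis using linear_0[OF lin] by simp
next
  case False
  define K where "K = S \<inter> sphere 0 1"
  have xK: "(1 / norm z) *\<^sub>R z \<in> K" if "z \<in> S" "z \<noteq> 0" for z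
    using that S by (simp add: K_def subspace_scale)
  have "compact K"
    unfolding K_def using closed_subspace[OF S] by (metis compact_sphere closed_Int_compact)
  moreover have "continuous_on K (\<lambda>z. norm (A z))"
    by (intro continuous_on_norm linear_continuous_on linear_conv_bounded_linear[THEN iffD1] lin)
  moreover have "K \<noteq> {}" using xK[OF x False] by blast
  ultimately obtain v where v: "v \<in> K" and vmax: "\<And>z. z \<in> K \<Longrightarrow> norm (A z) \<le> norm (A v)"
    using continuous_attains_sup[of K "\<lambda>z. norm (A z)"] by blast
  define m where "m = norm (A v)"
  have v1: "norm v = 1" and vS: "v \<in> S" using v by (auto simp: K_def)
  then have v0: "v \<noteq> 0" by auto
  have le: "norm (A z) \<le> m * norm z" if z: "z \<in> S" for z
  proof (cases "z = 0")
    case True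
    then show ?thesis using linear_0[OF lin] by simp
  next
    case False
    then show ?thesis
      using vmax[OF xK[OF z False]] by (simp add: m_def linear_scale[OF lin] field_simps)
  qed
  define r where "r = (m\<^sup>2) *\<^sub>R v - A (A v)"
  have rS: "r \<in> S" unfolding r_def by (intro subspace_diff subspace_scale S inv vS)
  text \<open>\<open>v\<close> minimises the nonnegative form \<open>m\<^sup>2 |z|\<^sup>2 - |A z|\<^sup>2\<close>; its first variation
    in the direction \<open>r\<close> is \<open>2 |r|\<^sup>2\<close>.\<close>
  have var: "0 \<le> 2 * t * (norm r)\<^sup>2 + t\<^sup>2 * (m\<^sup>2 * (norm r)\<^sup>2 - (norm (A r))\<^sup>2)" for t
  proof -
    have "v + t *\<^sub>R r \<in> S" by (intro subspace_add subspace_scale S vS rS)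
    then have "(norm (A (v + t *\<^sub>R r)))\<^sup>2 \<le> (m * norm (v + t *\<^sub>R r))\<^sup>2"
      by (intro power_mono le) auto
    then have "0 \<le> m\<^sup>2 * (norm (v + t *\<^sub>R r))\<^sup>2 - (norm (A v + t *\<^sub>R A r))\<^sup>2"
      by (simp add: linear_add[OF lin] linear_scale[OF lin] power_mult_distrib)
    also have "\<dots> = (m\<^sup>2 * (norm v)\<^sup>2 - (norm (A v))\<^sup>2) + 2 * t * (m\<^sup>2 * (v \<bullet> r) - A v \<bullet> A r)
        + t\<^sup>2 * (m\<^sup>2 * (norm r)\<^sup>2 - (norm (A r))\<^sup>2)"
      unfolding power2_norm_eq_inner
      by (simp add: inner_simps inner_commute algebra_simps power2_eq_square)
    also have "m\<^sup>2 * (v \<bullet> r) - A v \<bullet> A r = (norm r)\<^sup>2"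
      using sa[of "A v" r]
      by (simp add: r_def power2_norm_eq_inner inner_diff_left)
    also have "m\<^sup>2 * (norm v)\<^sup>2 - (norm (A v))\<^sup>2 = 0" by (simp add: v1 m_def)
    finally show ?thesis by simp
  qed
  have "r = 0"
  proof (rule ccontr)
    assume "r \<noteq> 0"
    define a where "a = (norm r)\<^sup>2"
    define Q where "Q = m\<^sup>2 * (norm r)\<^sup>2 - (norm (A r))\<^sup>2"
    have a: "0 < a" using \<open>r \<noteq> 0\<close> by (simp add: a_def)
    \<comment> \<open>A negative \<open>t\<close> this small keeps the quadratic term subordinate:
      \<open>t * Q\<close> has modulus at most \<open>a\<close>, so \<open>2 * a + t * Q\<close>
      stays positive.\<close>
    define t where "t = - a / (\<bar>Q\<bar> + 1)"
    have "t < 0" using a by (simp add: t_def field_simps)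
    have "0 \<le> t * (2 * a + t * Q)"
      using var[of t] by (simp add: a_def Q_def power2_eq_square algebra_simps)
    then have "2 * a + t * Q \<le> 0" using \<open>t < 0\<close> by (simp add: zero_le_mult_iff)
    moreover have "\<bar>t * Q\<bar> \<le> a"
    proof -
      have "\<bar>t * Q\<bar> = a * (\<bar>Q\<bar> / (\<bar>Q\<bar> + 1))" using a by (simp add: t_def abs_mult)
      also have "\<dots> \<le> a * 1" using a by (intro mult_left_mono) (auto simp: field_simps)
      finally show ?thesis by simp
    qed
    ultimately show False using a by linarith
  qed
  then have AA: "A (A v) = (m\<^sup>2) *\<^sub>R v" by (simp add: r_def)
  \<comment> \<open>Factor \<open>A\<^sup>2 - m\<^sup>2\<close> as \<open>(A - m) (A + m)\<close>:
    either \<open>A + m\<close> kills \<open>v\<close>, or the image of \<open>v\<close> under it is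
    an eigenvector for \<open>m\<close>.\<close>
  have "m \<le> b"
  proof (cases "A v + m *\<^sub>R v = 0")
    case True
    then have "A v = (- m) *\<^sub>R v" by (simp add: eq_neg_iff_add_eq_0)
    from ev[OF vS v0 this] show ?thesis by simp
  next
    case False
    have "A (A v + m *\<^sub>R v) = m *\<^sub>R (A v + m *\<^sub>R v)"
      by (simp add: linear_add[OF lin] linear_scale[OF lin] AA algebra_simps power2_eq_square)
    moreover have "A v + m *\<^sub>R v \<in> S" by (intro subspace_add subspace_scale S inv vS)
    ultimately have "\<bar>m\<bar> \<le> b" using ev False by blast
    then show ?thesis by simp
  qed
  then have "m * norm x \<le> b * norm x" by (intro mult_right_mono) auto
  with le[OF x] show ?thesis by linarith
qed

section \<open>Consensus steps on block vectors\<close>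

lemma block_stack [simp]: "block (stack v) i = v i"
  by (simp add: block_def stack_def vec_eq_iff)

lemma block_vec_eqI: "(\<And>i. block x i = block y i) \<Longrightarrow> x = y"
  by (auto simp: block_def vec_eq_iff)

lemma block_add [simp]: "block (x + y) i = block x i + block y i"
  by (simp add: block_def vec_eq_iff)

lemma block_diff [simp]: "block (x - y) i = block x i - block y i"
  by (simp add: block_def vec_eq_iff)

lemma block_scaleR [simp]: "block (c *\<^sub>R x) i = c *\<^sub>R block x i"
  by (simp add: block_def vec_eq_iff)

lemma block_0 [simp]: "block 0 i = 0"
  by (simp add: block_def vec_eq_iff)

lemma inner_block: "x \<bullet> y = (\<Sum>i\<in>UNIV. block x i \<bullet> block y i)"
  unfolding inner_vec_def block_def
  by (simp add: UNIV_Times_UNIV[symmetric] sum.cartesian_product del: UNIV_Times_UNIV)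

lemma norm_block: "(norm x)\<^sup>2 = (\<Sum>i\<in>UNIV. (norm (block x i))\<^sup>2)"
  by (simp only: power2_norm_eq_inner inner_block)

lemma norm_block_le: "norm (block x i) \<le> norm x"
proof -
  have "(norm (block x i))\<^sup>2 \<le> (norm x)\<^sup>2"
    unfolding norm_block by (rule member_le_sum) auto
  then show ?thesis by (rule power2_le_imp_le) simp
qed

lemma block_average_add: "block_average (x + y) = block_average x + block_average y"
  by (simp add: block_average_def sum.distrib scaleR_add_right)

lemma block_average_diff: "block_average (x - y) = block_average x - block_average y"
  by (simp add: block_average_def sum_subtractf scaleR_diff_right)

lemma block_average_scaleR: "block_average (c *\<^sub>R x) = c *\<^sub>R block_average x"
  by (simp add: block_average_def scaleR_sum_right[symmetric])

lemma block_average_stack_const [simp]: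
  "block_average (stack (\<lambda>_. c) :: real ^ ('n::finite \<times> 'p::finite)) = c"
  by (simp only: block_average_def block_stack sum_constant_scaleR) simp

text \<open>Cauchy-Schwarz against the all-ones vector; the source of the term
  \<open>D / sqrt n\<close> in \<open>Dhat\<close>.\<close>

lemma norm_block_average_le:
  fixes x :: "real ^ ('n::finite \<times> 'p::finite)"
  shows "norm (block_average x) \<le> norm x / sqrt (real CARD('n))"
proof -
  let ?n = "real CARD('n)"
  have "(\<Sum>i\<in>UNIV. norm (block x i) * 1) \<le> L2_set (\<lambda>i. norm (block x i)) UNIV * L2_set (\<lambda>_::'n. 1) UNIV"
    using L2_set_mult_ineq[of "\<lambda>i. norm (block x i)" "\<lambda>_. 1" UNIV] by simp
  then have le: "(\<Sum>i\<in>UNIV. norm (block x i)) \<le> norm x * sqrt ?n"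
    by (simp add: L2_set_def norm_block[symmetric])
  have "norm (block_average x) \<le> (1 / ?n) * (\<Sum>i\<in>UNIV. norm (block x i))"
    by (simp add: block_average_def norm_sum divide_right_mono)
  also have "\<dots> \<le> (1 / ?n) * (norm x * sqrt ?n)"
    by (intro mult_left_mono le) auto
  also have "\<dots> = norm x / sqrt ?n"
    by (simp add: real_div_sqrt field_simps)
  finally show ?thesis .
qed

text \<open>Removing the average is an orthogonal projection; by Pythagoras the squared norm drops
  by \<open>n\<close> times the squared norm of the average.\<close>

lemma norm_minus_block_average_le:
  fixes x :: "real ^ ('n::finite \<times> 'p::finite)"
  shows "norm (x - stack (\<lambda>_. block_average x)) \<le> norm x"
proof -
  define a where "a = block_average x"
  have s: "(\<Sum>i\<in>UNIV. block x i) = real CARD('n) *\<^sub>R a" by (simp add: a_def block_average_def)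
  have "(norm (x - stack (\<lambda>_. a)))\<^sup>2
      = (\<Sum>i\<in>UNIV. (norm (block x i))\<^sup>2 - 2 * (block x i \<bullet> a) + (norm a)\<^sup>2)"
    unfolding norm_block
    by (simp add: power2_norm_eq_inner inner_simps inner_commute algebra_simps)
  also have "\<dots> = (norm x)\<^sup>2 - 2 * ((\<Sum>i\<in>UNIV. block x i) \<bullet> a) + real CARD('n) * (norm a)\<^sup>2"
    unfolding norm_block[of x]
    by (simp add: sum.distrib sum_subtractf sum_distrib_left inner_sum_left)
  also have "\<dots> = (norm x)\<^sup>2 - real CARD('n) * (norm a)\<^sup>2"
    unfolding s by (simp add: power2_norm_eq_inner)
  also have "\<dots> \<le> (norm x)\<^sup>2" by simp
  finally show ?thesis unfolding a_def by (rule power2_le_imp_le) simp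
qed

lemma block_kronecker_mat_1:
  "block (kronecker W (mat 1) *v x) i = (\<Sum>j\<in>UNIV. W $ i $ j *\<^sub>R block x j)"
proof -
  have "(\<Sum>r\<in>UNIV. W $ i $ fst r * (if q = snd r then 1 else 0) * x $ r)
      = (\<Sum>j\<in>UNIV. W $ i $ j * x $ (j, q))" for q
  proof -
    have "(\<Sum>r\<in>UNIV. W $ i $ fst r * (if q = snd r then 1 else 0) * x $ r)
      = (\<Sum>j\<in>UNIV. \<Sum>s\<in>UNIV. W $ i $ j * (if q = s then 1 else 0) * x $ (j, s))"
      unfolding UNIV_Times_UNIV[symmetric] sum.cartesian_product by (simp add: case_prod_beta)
    also have "\<dots> = (\<Sum>j\<in>UNIV. W $ i $ j * x $ (j, q))"
      by (intro sum.cong refl) (subst sum.remove[of _ q], auto)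
    finally show ?thesis .
  qed
  then show ?thesis
    by (simp add: block_def vec_eq_iff matrix_vector_mult_def kronecker_def mat_def)
qed

lemma transpose_kronecker: "transpose (kronecker A B) = kronecker (transpose A) (transpose B)"
  by (simp add: kronecker_def transpose_def vec_eq_iff)

context
  fixes E :: "('n::finite \<times> 'n) set" and W :: "real ^ 'n ^ 'n"
  assumes W: "consensus_matrix E W"
begin

lemma block_average_consensus:
  "block_average (kronecker W (mat 1) *v x) = block_average x"
proof -
  have "(\<Sum>i\<in>UNIV. \<Sum>j\<in>UNIV. W $ i $ j *\<^sub>R block x j)
      = (\<Sum>j\<in>UNIV. (\<Sum>i\<in>UNIV. W $ i $ j) *\<^sub>R block x j)"
    by (subst sum.swap) (simp add: scaleR_sum_left)
  then show ?thesis
    using W by (simp add: block_average_def block_kronecker_mat_1 consensus_matrix_def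
        doubly_stochastic_def)
qed

lemma consensus_stack_const:
  "kronecker W (mat 1) *v stack (\<lambda>_. c) = stack (\<lambda>_. c)"
  using W by (intro block_vec_eqI)
    (simp add: block_kronecker_mat_1 scaleR_sum_left[symmetric] consensus_matrix_def
        doubly_stochastic_def)

lemma consensus_selfadjoint:
  "(kronecker W (mat 1) *v x) \<bullet> y = x \<bullet> (kronecker W (mat 1) *v y)"
proof -
  have "transpose (kronecker W (mat 1)) = kronecker W (mat 1)"
    using W by (simp add: transpose_kronecker consensus_matrix_def)
  then show ?thesis by (metis dot_lmul_matrix vector_transpose_matrix)
qed

text \<open>Fixing a coordinate \<open>q\<close> decouples the Kronecker product into copies of
  \<open>W\<close>. Some slice of a nonzero vector is nonzero, so every eigenvalue of the product is
  one of \<open>W\<close>.\<close>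

lemma kronecker_eigenvector:
  assumes v: "kronecker W (mat 1) *v v = l *\<^sub>R v"
  shows "W *v (\<chi> i. block v i $ q) = l *\<^sub>R (\<chi> i. block v i $ q)"
proof -
  have "(\<Sum>j\<in>UNIV. W $ i $ j *\<^sub>R block v j) = l *\<^sub>R block v i" for i
    using arg_cong[OF v, of "\<lambda>z. block z i"] by (simp add: block_kronecker_mat_1)
  from arg_cong[OF this, of "\<lambda>z. z $ q"] show ?thesis
    by (simp add: vec_eq_iff matrix_vector_mult_def)
qed

lemma norm_consensus_le: "norm (kronecker W (mat 1) *v x) \<le> norm x"
proof -
  have "norm (kronecker W (mat 1) *v x) \<le> 1 * norm x"
  proof (rule selfadjoint_norm_le_eigenvalue_bound[where S = UNIV])
    fix v l assume "v \<noteq> 0" and v: "kronecker W (mat 1) *v v = l *\<^sub>R v"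
    from \<open>v \<noteq> 0\<close> obtain i q where "block v i $ q \<noteq> 0"
      by (auto simp: vec_eq_iff block_def)
    then have "(\<chi> i. block v i $ q) \<noteq> 0" by (auto simp: vec_eq_iff)
    then have "eigenvalue W l" using kronecker_eigenvector[OF v] by (auto simp: eigenvalue_def)
    then show "\<bar>l\<bar> \<le> 1" using consensus_eigenvalue_less_1[OF W] by fastforce
  qed (auto simp: consensus_selfadjoint)
  then show ?thesis by simp
qed

text \<open>Eigenvectors of \<open>W\<close> for the eigenvalue 1 are constant, and a constant slice
  with average zero vanishes. Only eigenvalues other than 1 therefore remain on this subspace, and
  these are bounded by \<open>\<beta>\<close>.\<close>

lemma norm_consensus_disagreement_le:
  assumes E: "connected_graph E" and \<beta>: "second_largest_abs_eigenvalue W \<beta>"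
    and x: "block_average x = 0"
  shows "norm (kronecker W (mat 1) *v x) \<le> \<beta> * norm x"
proof (rule selfadjoint_norm_le_eigenvalue_bound[where S = "{x. block_average x = 0}"])
  fix v l assume avg: "v \<in> {x. block_average x = 0}" and "v \<noteq> 0"
    and v: "kronecker W (mat 1) *v v = l *\<^sub>R v"
  from \<open>v \<noteq> 0\<close> obtain i q where iq: "block v i $ q \<noteq> 0"
    by (auto simp: vec_eq_iff block_def)
  define u where "u = (\<chi> i. block v i $ q)"
  have u: "W *v u = l *\<^sub>R u" unfolding u_def by (rule kronecker_eigenvector[OF v])
  have "l \<noteq> 1"
  proof
    assume "l = 1"
    then have const: "u $ j = u $ i" for j
      using consensus_eigenvector_const[OF E W] u by simp
    have "(\<Sum>j\<in>UNIV. block v j) $ q = 0"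
      using avg by (simp add: block_average_def)
    then have "(\<Sum>j\<in>UNIV. u $ j) = 0"
      by (simp add: u_def)
    moreover have "(\<Sum>j\<in>UNIV. u $ j) = (\<Sum>j\<in>(UNIV :: 'n set). u $ i)"
      by (intro sum.cong refl const)
    ultimately show False using iq by (simp add: u_def)
  qed
  moreover have "u \<noteq> 0" using iq by (auto simp: u_def vec_eq_iff)
  ultimately show "\<bar>l\<bar> \<le> \<beta>"
    using \<beta> u by (auto simp: second_largest_abs_eigenvalue_def eigenvalue_def)
next
  show "subspace {x. block_average x = 0}"
    by (auto simp: subspace_def block_average_add block_average_scaleR)
       (simp add: block_average_def)
qed (use x in \<open>auto simp: consensus_selfadjoint block_average_consensus\<close>)

lemma block_average_consensus_power:
  "block_average (matrix_power (kronecker W (mat 1)) k *v x) = block_average x"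
  by (induction k) (auto simp: matrix_vector_mul_assoc[symmetric] block_average_consensus)

lemma norm_consensus_power_le: "norm (matrix_power (kronecker W (mat 1)) k *v x) \<le> norm x"
  by (induction k)
    (auto simp: matrix_vector_mul_assoc[symmetric] intro: order_trans[OF norm_consensus_le])

text \<open>Consensus fixes the average and contracts the rest. The right side has the full norm of
  \<open>x\<close>, not its disagreement, because the available uniform bound is on
  \<open>norm (y k)\<close>.\<close>

lemma norm_consensus_power_disagreement_le:
  fixes x :: "real ^ ('n \<times> 'p::finite)"
  assumes E: "connected_graph E" and \<beta>: "second_largest_abs_eigenvalue W \<beta>"
  shows "norm (matrix_power (kronecker W (mat 1)) k *v x - stack (\<lambda>_. block_average x))
    \<le> \<beta> ^ k * norm x"
proof (induction k)
  case 0
  then show ?case by (simp add: norm_minus_block_average_le)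
next
  case (Suc k)
  let ?Z = "kronecker W (mat 1) :: real ^ ('n \<times> 'p) ^ ('n \<times> 'p)"
  let ?d = "matrix_power ?Z k *v x - stack (\<lambda>_. block_average x)"
  have "0 \<le> \<beta>" using \<beta> by (auto simp: second_largest_abs_eigenvalue_def)
  have "matrix_power ?Z (Suc k) *v x - stack (\<lambda>_. block_average x) = ?Z *v ?d"
    by (simp add: matrix_vector_mul_assoc[symmetric] matrix_vector_mult_diff_distrib
        consensus_stack_const)
  also have "norm \<dots> \<le> \<beta> * norm ?d"
    by (rule norm_consensus_disagreement_le[OF E \<beta>])
      (simp add: block_average_diff block_average_consensus_power)
  also have "\<dots> \<le> \<beta> * (\<beta> ^ k * norm x)"
    by (intro mult_left_mono Suc \<open>0 \<le> \<beta>\<close>)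
  finally show ?case by simp
qed

end

section \<open>Errors of averaged local gradient steps\<close>

text \<open>The arithmetic-geometric mean inequality at the extreme step length
  \<open>2 / (m + L)\<close>. It keeps the squared contraction factors nonnegative.\<close>

lemma step_rate_le_1:
  fixes m L \<alpha> :: real
  assumes "0 < m" "0 < L" "\<alpha> \<le> 2 / (m + L)"
  shows "\<alpha> * (2 * m * L / (m + L)) \<le> 1"
proof -
  have "\<alpha> * (2 * m * L / (m + L)) \<le> 2 / (m + L) * (2 * m * L / (m + L))"
    using assms by (intro mult_right_mono) auto
  also have "\<dots> = 4 * m * L / (m + L)\<^sup>2" by (simp add: power2_eq_square)
  also have "\<dots> \<le> 1"
  proof -
    have "4 * m * L \<le> (m + L)\<^sup>2"
      using zero_le_power2[of "m - L"] by (simp add: power2_eq_square algebra_simps)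
    then show ?thesis using assms by (simp add: divide_le_eq_1_pos)
  qed
  finally show ?thesis .
qed

lemma norm_stacked_gradient_step_le:
  assumes "\<And>i. (norm ((block x i - \<alpha> *\<^sub>R g i (block x i)) - u i))\<^sup>2 \<le> c * (norm (block x i - u i))\<^sup>2"
  shows "(norm (gradient_step \<alpha> g x - stack u))\<^sup>2 \<le> c * (norm (x - stack u))\<^sup>2"
proof -
  have "(norm (gradient_step \<alpha> g x - stack u))\<^sup>2
      = (\<Sum>i\<in>UNIV. (norm ((block x i - \<alpha> *\<^sub>R g i (block x i)) - u i))\<^sup>2)"
    by (simp add: norm_block gradient_step_def stacked_gradient_def)
  also have "\<dots> \<le> (\<Sum>i\<in>UNIV. c * (norm (block x i - u i))\<^sup>2)"
    by (intro sum_mono assms)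
  also have "\<dots> = c * (norm (x - stack u))\<^sup>2"
    by (simp add: norm_block sum_distrib_left)
  finally show ?thesis .
qed

lemma block_gradient_step_power:
  "block ((gradient_step \<alpha> g ^^ j) x) i = ((\<lambda>z. z - \<alpha> *\<^sub>R g i z) ^^ j) (block x i)"
  by (induction j) (simp_all add: gradient_step_def stacked_gradient_def)

text \<open>The affine map has the fixed point \<open>4 / \<nu> * u - 2 * u\<close>; the claimed
  bound lies above it and is thus preserved by the map.\<close>

lemma affine_recursion_bound:
  fixes Y :: "nat \<Rightarrow> real"
  assumes step: "\<And>k. Y (Suc k) \<le> (1 - \<nu> / 2) * (Y k + 2 * u)"
    and \<nu>: "0 < \<nu>" "\<nu> \<le> 2" and nn: "0 \<le> Y 0" "0 \<le> u"
  shows "Y k \<le> Y 0 + 4 / \<nu> * u"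
proof (induction k)
  case 0
  then show ?case using \<nu> nn by simp
next
  case (Suc k)
  have "Y (Suc k) \<le> (1 - \<nu> / 2) * (Y k + 2 * u)" by (rule step)
  also have "\<dots> \<le> (1 - \<nu> / 2) * ((Y 0 + 4 / \<nu> * u) + 2 * u)"
    using \<nu> Suc by (intro mult_left_mono) auto
  also have "\<dots> = Y 0 + 4 / \<nu> * u - (\<nu> / 2 * Y 0 + \<nu> * u)"
    using \<nu> by (simp add: field_simps)
  also have "\<dots> \<le> Y 0 + 4 / \<nu> * u"
  proof -
    have "0 \<le> \<nu> / 2 * Y 0 + \<nu> * u"
      using \<nu> nn by (intro add_nonneg_nonneg mult_nonneg_nonneg) auto
    then show ?thesis by linarith
  qed
  finally show ?case .
qed

text \<open>The recursion starts at \<open>k = 1\<close> with the exponent \<open>k - 1\<close>,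
  because the disagreement of the first two iterates has not been reduced by consensus;
  \<open>e 1\<close> is bounded separately.\<close>

lemma perturbed_linear_rate:
  fixes e :: "nat \<Rightarrow> real"
  assumes s: "0 < s" "s \<le> 1" and \<rho>: "1 - s / 2 \<le> \<rho>"
    and e0: "e 0 \<le> C" and e1: "e 1 \<le> C * \<rho>"
    and step: "\<And>k. 1 \<le> k \<Longrightarrow> e (Suc k) \<le> sqrt (1 - s) * e k + K * \<rho> ^ (k - 1)"
    and K: "0 \<le> K" "8 * K / s\<^sup>2 \<le> C"
  shows "e k \<le> C * \<rho> ^ k"
proof -
  define q where "q = sqrt (1 - s)"
  define r where "r = 1 - s / 2"
  have q0: "0 \<le> q" using s by (simp add: q_def)
  have q2: "q\<^sup>2 = 1 - s" using s by (simp add: q_def)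
  have r0: "0 < r" using s by (simp add: r_def)
  have r2: "r\<^sup>2 - q\<^sup>2 = s\<^sup>2 / 4" unfolding q2 by (simp add: r_def power2_eq_square field_simps)
  have "q\<^sup>2 \<le> r\<^sup>2" using r2 zero_le_power2[of s] by linarith
  then have qr: "q \<le> r" by (rule power2_le_imp_le) (use r0 in simp)
  have rr: "r \<le> \<rho>" using \<rho> by (simp add: r_def)
  have "0 \<le> C" using K s
    by (meson divide_nonneg_nonneg mult_nonneg_nonneg order_trans zero_le_numeral zero_le_power2)
  have K': "K \<le> C * (s\<^sup>2 / 8)" using K s by (simp add: divide_le_eq)
  text \<open>The slack between \<open>sqrt (1 - s)\<close> and \<open>1 - s / 2\<close> pays for the perturbation, even
    though the latter lags one step behind.\<close>
  have gap: "q * \<rho> + s\<^sup>2 / 8 \<le> \<rho>\<^sup>2"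
  proof -
    \<comment> \<open>Half the difference of the squares of \<open>r\<close> and \<open>q\<close>;
      the mean \<open>(r + q) / 2\<close> is at most \<open>r\<close>, hence at most
      \<open>\<rho>\<close>.\<close>
    have "s\<^sup>2 / 8 = (r + q) / 2 * (r - q)" using r2 by (simp add: power2_eq_square field_simps)
    also have "\<dots> \<le> \<rho> * (\<rho> - q)" using qr rr r0 q0 by (intro mult_mono) auto
    finally show ?thesis by (simp add: power2_eq_square algebra_simps)
  qed
  show ?thesis
  proof (induction k)
    case 0
    then show ?case using e0 by simp
  next
    case (Suc k)
    show ?case
    proof (cases k)
      case 0
      then show ?thesis using e1 by simp
    next
      case (Suc l)
      have "e (Suc k) \<le> q * e k + K * \<rho> ^ l" using step[of k] Suc by (simp add: q_def)
      also have "\<dots> \<le> q * (C * \<rho> ^ k) + C * (s\<^sup>2 / 8) * \<rho> ^ l"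
        using Suc.IH K' q0 rr r0 by (intro add_mono mult_left_mono mult_right_mono) auto
      also have "\<dots> = C * \<rho> ^ l * (q * \<rho> + s\<^sup>2 / 8)" using Suc by (simp add: algebra_simps)
      also have "\<dots> \<le> C * \<rho> ^ l * \<rho>\<^sup>2"
        using gap \<open>0 \<le> C\<close> rr r0 by (intro mult_left_mono) auto
      also have "\<dots> = C * \<rho> ^ Suc k" using Suc by (simp add: power2_eq_square)
      finally show ?thesis .
    qed
  qed
qed

text \<open>The excess in Bernoulli's inequality. With \<open>h = \<alpha> * L\<close> and
  \<open>t = tg k\<close> it is \<open>T k\<close>.\<close>

definition power_excess :: "real \<Rightarrow> nat \<Rightarrow> real" where
  "power_excess h t = (1 + h) ^ t - 1 - real t * h"

lemma power_excess_Suc: "power_excess h (Suc t) = power_excess h t + h * ((1 + h) ^ t - 1)"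
  by (simp add: power_excess_def algebra_simps)

lemma power_excess_0_1 [simp]: "power_excess h 0 = 0" "power_excess h (Suc 0) = 0"
  by (simp_all add: power_excess_def)

lemma power_excess_mono: "0 \<le> h \<Longrightarrow> mono (power_excess h)"
  by (rule monoI[OF lift_Suc_mono_le]) (simp_all add: power_excess_Suc)

lemma power_excess_nonneg: "0 \<le> h \<Longrightarrow> 0 \<le> power_excess h t"
  using monoD[OF power_excess_mono, of h 0 t] by simp

text \<open>The excess vanishes at both 0 and 1, so strict growth begins at \<open>t = 1\<close>.
  This is what makes \<open>\<tau> < 1\<close>.\<close>

lemma power_excess_less_Suc: "0 < h \<Longrightarrow> 1 \<le> t \<Longrightarrow> power_excess h t < power_excess h (Suc t)"
  by (simp add: power_excess_Suc one_less_power)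

text \<open>Equality holds at \<open>t = 2\<close>. The bound keeps \<open>T 0\<close> away from
  zero when the first round has several gradient steps.\<close>

lemma power_excess_ge_square: "0 \<le> h \<Longrightarrow> 2 \<le> t \<Longrightarrow> h\<^sup>2 \<le> power_excess h t"
  using monoD[OF power_excess_mono, of h 2 t] by (simp add: numeral_2_eq_2 power_excess_Suc)

text \<open>The mean distance of the local iterates \<open>v\<close> from the comparison iterate
  \<open>z\<close> grows by the factor \<open>1 + h\<close> per step, with forcing
  \<open>\<alpha> * G\<close>. The deviation of the averages accumulates \<open>h\<close> times this
  distance, so heterogeneity enters only at second order in \<open>h\<close>, through
  \<open>power_excess\<close>.\<close>

lemma local_descent_average_error:
  fixes g :: "'n::finite \<Rightarrow> 'a::real_normed_vector \<Rightarrow> 'a"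
  defines "avg \<equiv> \<lambda>a :: 'n \<Rightarrow> 'a. (1 / real CARD('n)) *\<^sub>R (\<Sum>i\<in>UNIV. a i)"
    and "avgn \<equiv> \<lambda>a :: 'n \<Rightarrow> 'a. (1 / real CARD('n)) * (\<Sum>i\<in>UNIV. norm (a i))"
  assumes v: "\<And>j i. v (Suc j) i = v j i - \<alpha> *\<^sub>R g i (v j i)"
    and z: "\<And>j. z (Suc j) = z j - \<alpha> *\<^sub>R avg (\<lambda>i. g i (z j))"
    and z0: "z 0 = avg (v 0)"
    and \<alpha>: "0 \<le> \<alpha>" and L: "0 < L"
    and lip: "\<And>i a b. norm (g i a - g i b) \<le> L * norm (a - b)"
    and d: "avgn (\<lambda>i. v 0 i - z 0) \<le> d"
    and G: "\<And>j. avgn (\<lambda>i. g i (z j) - avg (\<lambda>i. g i (z j))) \<le> G"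
  shows "norm (avg (v t) - z t)
    \<le> d * ((1 + \<alpha> * L) ^ t - 1) + G / L * power_excess (\<alpha> * L) t"
proof -
  define h where "h = \<alpha> * L"
  have h: "0 \<le> h" using \<alpha> L by (simp add: h_def)
  have avgn_mono: "avgn a \<le> (1 / real CARD('n)) * (\<Sum>i\<in>UNIV. B i)" if "\<And>i. norm (a i) \<le> B i" for a B
    unfolding avgn_def by (intro mult_left_mono sum_mono that) auto
  have norm_avg: "norm (avg a) \<le> avgn a" for a
    by (simp add: avg_def avgn_def norm_sum divide_right_mono)
  have spread: "avgn (\<lambda>i. v j i - z j) \<le> d * (1 + h) ^ j + G / L * ((1 + h) ^ j - 1)" for j
  proof (induction j)
    case 0
    then show ?case using d by simp
  next
    case (Suc j)
    have "norm (v (Suc j) i - z (Suc j)) \<le> (1 + h) * norm (v j i - z j)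
        + \<alpha> * norm (g i (z j) - avg (\<lambda>i. g i (z j)))" for i
    proof -
      have "v (Suc j) i - z (Suc j) = (v j i - z j) - \<alpha> *\<^sub>R (g i (v j i) - g i (z j))
          - \<alpha> *\<^sub>R (g i (z j) - avg (\<lambda>i. g i (z j)))"
        by (simp add: v z algebra_simps)
      also have "norm \<dots> \<le> norm (v j i - z j) + norm (\<alpha> *\<^sub>R (g i (v j i) - g i (z j)))
          + norm (\<alpha> *\<^sub>R (g i (z j) - avg (\<lambda>i. g i (z j))))"
        by (intro order_trans[OF norm_triangle_ineq4] add_mono norm_triangle_ineq4 order_refl)
      also have "norm (\<alpha> *\<^sub>R (g i (v j i) - g i (z j))) \<le> \<alpha> * (L * norm (v j i - z j))"
        using \<alpha> lip by (simp add: mult_left_mono)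
      also have "norm (\<alpha> *\<^sub>R (g i (z j) - avg (\<lambda>i. g i (z j))))
          = \<alpha> * norm (g i (z j) - avg (\<lambda>i. g i (z j)))"
        using \<alpha> by simp
      finally show ?thesis by (simp add: h_def algebra_simps)
    qed
    from avgn_mono[of "\<lambda>i. v (Suc j) i - z (Suc j)", OF this]
    have "avgn (\<lambda>i. v (Suc j) i - z (Suc j))
        \<le> (1 + h) * avgn (\<lambda>i. v j i - z j) + \<alpha> * avgn (\<lambda>i. g i (z j) - avg (\<lambda>i. g i (z j)))"
      by (simp add: avgn_def sum.distrib sum_distrib_left[symmetric] ring_distribs mult_ac add_divide_distrib)
    also have "\<dots> \<le> (1 + h) * (d * (1 + h) ^ j + G / L * ((1 + h) ^ j - 1)) + \<alpha> * G"
      using Suc G \<alpha> h by (intro add_mono mult_left_mono) auto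
    also have "\<alpha> * G = G / L * h" using L by (simp add: h_def)
    finally show ?case by (simp add: algebra_simps add_divide_distrib)
  qed
  have "norm (avg (v t) - z t) \<le> d * ((1 + h) ^ t - 1) + G / L * power_excess h t"
  proof (induction t)
    case 0
    then show ?case by (simp add: z0)
  next
    case (Suc j)
    \<comment> \<open>The terms \<open>g i (z j) - avg (...)\<close> average to zero, so only
      gradient differences between \<open>v\<close> and \<open>z\<close> remain.\<close>
    have "avg (v (Suc j)) - z (Suc j)
        = (avg (v j) - z j) - \<alpha> *\<^sub>R avg (\<lambda>i. g i (v j i) - g i (z j))"
      by (simp add: v z avg_def sum_subtractf scaleR_sum_right[symmetric] algebra_simps)
    also have "norm \<dots> \<le> norm (avg (v j) - z j) + \<alpha> * norm (avg (\<lambda>i. g i (v j i) - g i (z j)))"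
      using norm_triangle_ineq4 \<alpha> by (metis abs_of_nonneg norm_scaleR)
    also have "norm (avg (\<lambda>i. g i (v j i) - g i (z j))) \<le> L * avgn (\<lambda>i. v j i - z j)"
    proof -
      have "norm (avg (\<lambda>i. g i (v j i) - g i (z j))) \<le> avgn (\<lambda>i. g i (v j i) - g i (z j))"
        by (rule norm_avg)
      also have "\<dots> \<le> (1 / real CARD('n)) * (\<Sum>i\<in>UNIV. L * norm (v j i - z j))"
        by (intro avgn_mono lip)
      also have "\<dots> = L * avgn (\<lambda>i. v j i - z j)"
        by (simp add: avgn_def sum_distrib_left[symmetric])
      finally show ?thesis .
    qed
    also have "\<alpha> * (L * avgn (\<lambda>i. v j i - z j)) = h * avgn (\<lambda>i. v j i - z j)"
      by (simp add: h_def)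
    also have "norm (avg (v j) - z j) + h * avgn (\<lambda>i. v j i - z j)
        \<le> (d * ((1 + h) ^ j - 1) + G / L * power_excess h j)
          + h * (d * (1 + h) ^ j + G / L * ((1 + h) ^ j - 1))"
      by (intro add_mono Suc mult_left_mono spread h)
    also have "\<dots> = d * ((1 + h) ^ Suc j - 1) + G / L * power_excess h (Suc j)"
      by (simp add: power_excess_Suc algebra_simps)
    finally show ?case using \<alpha> by (simp add: mult_left_mono)
  qed
  then show ?thesis by (simp add: h_def)
qed

text \<open>Triangle inequality through the comparison iterates. Their contraction
  \<open>q ^ t\<close> is weakened to \<open>q\<close>, which makes the rate uniform in
  \<open>t\<close>; their distance to \<open>xs\<close> stays below \<open>R\<close>, which bounds
  the heterogeneity of the gradients along them.\<close>

lemma averaged_gradient_steps_error: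
  fixes g :: "'n::finite \<Rightarrow> real ^ 'p::finite \<Rightarrow> real ^ 'p" and X :: "real ^ ('n \<times> 'p)"
  defines "gbar \<equiv> \<lambda>z. (1 / real CARD('n)) *\<^sub>R (\<Sum>i\<in>UNIV. g i z)"
  assumes contr: "\<And>z. norm ((z - \<alpha> *\<^sub>R gbar z) - xs) \<le> q * norm (z - xs)"
    and q: "0 \<le> q" "q \<le> 1" and zero: "gbar xs = 0"
    and \<alpha>: "0 \<le> \<alpha>" and L: "0 < L"
    and lip: "\<And>i a b. norm (g i a - g i b) \<le> L * norm (a - b)"
    and R: "norm (block_average X - xs) \<le> R"
    and d: "norm (X - stack (\<lambda>_. block_average X)) \<le> d"
    and t: "1 \<le> t"
  shows "norm (block_average ((gradient_step \<alpha> g ^^ t) X) - xs)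
    \<le> q * norm (block_average X - xs) + d * ((1 + \<alpha> * L) ^ t - 1)
      + (2 * L * R + (\<Sum>i\<in>UNIV. norm (g i xs))) / L * power_excess (\<alpha> * L) t"
proof -
  let ?n = "real CARD('n)"
  define v where "v j i = ((\<lambda>z. z - \<alpha> *\<^sub>R g i z) ^^ j) (block X i)" for j i
  define z where "z j = ((\<lambda>z. z - \<alpha> *\<^sub>R gbar z) ^^ j) (block_average X)" for j
  define S where "S = (\<Sum>i\<in>UNIV. norm (g i xs))"
  have n: "1 \<le> ?n" by (simp add: Suc_le_eq)
  have R0: "0 \<le> R" using R norm_ge_zero order_trans by blast
  have S0: "0 \<le> S" by (simp add: S_def sum_nonneg)
  have zpow: "norm (z j - xs) \<le> q ^ j * norm (block_average X - xs)" for j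
  proof (induction j)
    case 0
    then show ?case by (simp add: z_def)
  next
    case (Suc j)
    have "norm (z (Suc j) - xs) \<le> q * norm (z j - xs)" using contr by (simp add: z_def)
    also have "\<dots> \<le> q * (q ^ j * norm (block_average X - xs))" using Suc q by (intro mult_left_mono)
    finally show ?case by simp
  qed
  have zR: "norm (z j - xs) \<le> R" for j
  proof -
    have "q ^ j * norm (block_average X - xs) \<le> 1 * norm (block_average X - xs)"
      using q by (intro mult_right_mono power_le_one) auto
    then show ?thesis using zpow[of j] R by linarith
  qed
  have gd: "norm (g i (z j) - g i xs) \<le> L * R" for i j
    using order_trans[OF lip mult_left_mono[OF zR]] L by auto
  have gbard: "norm (gbar (z j)) \<le> L * R" for j
  proof -
    have "gbar (z j) = (1 / ?n) *\<^sub>R (\<Sum>i\<in>UNIV. g i (z j) - g i xs)"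
      using zero by (simp add: gbar_def sum_subtractf scaleR_diff_right)
    also have "norm \<dots> \<le> (1 / ?n) * (\<Sum>i\<in>(UNIV::'n set). L * R)"
      unfolding norm_scaleR using gd
      by (simp add: sum_norm_le divide_right_mono del: sum_constant)
    finally show ?thesis by simp
  qed
  have G: "(1 / ?n) * (\<Sum>i\<in>UNIV. norm (g i (z j) - gbar (z j))) \<le> 2 * L * R + S" for j
  proof -
    have "norm (g i (z j) - gbar (z j)) \<le> 2 * L * R + norm (g i xs)" for i
      using norm_triangle_ineq4[of "g i (z j)" "gbar (z j)"] norm_triangle_sub[of "g i (z j)" "g i xs"]
        gd[of i j] gbard[of j] by linarith
    then have "(1 / ?n) * (\<Sum>i\<in>UNIV. norm (g i (z j) - gbar (z j)))
        \<le> (1 / ?n) * (\<Sum>i\<in>UNIV. 2 * L * R + norm (g i xs))"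
      by (intro mult_left_mono sum_mono) auto
    also have "\<dots> = 2 * L * R + S / ?n" by (simp add: S_def sum.distrib add_divide_distrib)
    \<comment> \<open>Dropping the factor \<open>1 / n\<close> here produces exactly the constant
      \<open>M\<close> of the theorem.\<close>
    also have "S / ?n \<le> S / 1" using S0 n by (intro divide_left_mono) auto
    finally show ?thesis by simp
  qed
  have dev: "(1 / ?n) * (\<Sum>i\<in>UNIV. norm (v 0 i - z 0)) \<le> d"
  proof -
    have "norm (v 0 i - z 0) \<le> d" for i
      using norm_block_le[of "X - stack (\<lambda>_. block_average X)" i] d by (simp add: v_def z_def)
    then have "(1 / ?n) * (\<Sum>i\<in>UNIV. norm (v 0 i - z 0)) \<le> (1 / ?n) * (\<Sum>i\<in>(UNIV::'n set). d)"
      by (intro mult_left_mono sum_mono) auto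
    then show ?thesis by simp
  qed
  have "norm ((1 / ?n) *\<^sub>R (\<Sum>i\<in>UNIV. v t i) - z t)
      \<le> d * ((1 + \<alpha> * L) ^ t - 1) + (2 * L * R + S) / L * power_excess (\<alpha> * L) t"
    by (rule local_descent_average_error[where g = g])
      (use \<alpha> L lip dev G in \<open>simp_all add: v_def z_def gbar_def block_average_def\<close>)
  moreover have "(1 / ?n) *\<^sub>R (\<Sum>i\<in>UNIV. v t i) = block_average ((gradient_step \<alpha> g ^^ t) X)"
    by (simp add: block_average_def block_gradient_step_power v_def)
  moreover have "norm (z t - xs) \<le> q * norm (block_average X - xs)"
  proof -
    have "q ^ t \<le> q ^ 1" using q t by (intro power_decreasing) auto
    then have "q ^ t * norm (block_average X - xs) \<le> q * norm (block_average X - xs)"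
      by (intro mult_right_mono) auto
    then show ?thesis using zpow[of t] by linarith
  qed
  ultimately show ?thesis
    using norm_triangle_ineq[of "block_average ((gradient_step \<alpha> g ^^ t) X) - z t" "z t - xs"]
    by (simp add: S_def)
qed

section \<open>Convergence\<close>

theorem mainTheorem2:
  fixes E :: "('n::finite \<times> 'n) set"
    and W :: "real ^ 'n ^ 'n"
    and \<beta> :: real
    and f :: "'n \<Rightarrow> real ^ 'p::finite \<Rightarrow> real"
    and grad :: "'n \<Rightarrow> real ^ 'p \<Rightarrow> real ^ 'p"
    and Lip \<mu> \<gamma>loc :: "'n \<Rightarrow> real"
    and L \<mu>bar Lbar \<gamma> \<nu> :: real
    and \<alpha> :: real
    and s0 xstar :: "real ^ 'p"
    and ustar :: "'n \<Rightarrow> real ^ 'p"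
    and tc tg :: "nat \<Rightarrow> nat"
    and x y :: "nat \<Rightarrow> real ^ ('n \<times> 'p)"
    and xbar :: "nat \<Rightarrow> real ^ 'p"
    and \<eta> D Dhat M c2 c3 c4 c5 c3hat c5hat \<tau> C \<rho> :: real
    and T :: "nat \<Rightarrow> real"
  assumes graph: "connected_graph E"
    and consensus: "consensus_matrix E W"
    and beta: "second_largest_abs_eigenvalue W \<beta>" "0 < \<beta>" "\<beta> < 1"
    and convex: "\<And>i. convex_on UNIV (f i)"
    and gradient: "\<And>i z. GDERIV (f i) z :> grad i z"
    and constants_pos: "\<And>i. 0 < Lip i" "\<And>i. 0 < \<mu> i"
    and lipschitz: "\<And>i. (Lip i)-lipschitz_on UNIV (grad i)"
    and strong: "\<And>i. strongly_convex (\<mu> i) (f i)"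
    and xstar: "is_arg_min (\<lambda>z. \<Sum>i\<in>UNIV. f i z) (\<lambda>_. True) xstar"
    and ustar: "\<And>i. is_arg_min (f i) (\<lambda>_. True) (ustar i)"
    and L: "L = Max (range Lip)"
    and mubar: "\<mu>bar = (1 / real CARD('n)) * (\<Sum>i\<in>UNIV. \<mu> i)"
    and Lbar: "Lbar = (1 / real CARD('n)) * (\<Sum>i\<in>UNIV. Lip i)"
    and c4: "c4 = 2 / (\<mu>bar + Lbar)"
    and steplength: "0 < \<alpha>" "\<alpha> \<le> min (1 / L) c4"
    and tc: "\<And>k. tc k = k"
    and tg: "1 \<le> tg 0" "\<And>k. tg k = max (tg 0 - k) 1"
    and x: "\<And>k. x k = near_dgd W grad \<alpha> tc tg s0 k"
    and y: "\<And>k. y k = (gradient_step \<alpha> grad ^^ tg k) (x k)"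
    and xbar: "\<And>k. xbar k = block_average (x k)"
    and gamma_loc: "\<And>i. \<gamma>loc i = \<mu> i * Lip i / (\<mu> i + Lip i)"
    and gamma: "\<gamma> = Min (range \<gamma>loc)"
    and nu: "\<nu> = 2 * \<alpha> * \<gamma>"
    and D: "D = norm (y 0 - stack ustar) + (\<nu> + 4) / \<nu> * norm (stack ustar)"
    and Dhat: "Dhat = norm xstar + D / sqrt (real CARD('n))"
    and M: "M = 2 * L * Dhat + (\<Sum>i\<in>UNIV. norm (grad i xstar))"
    and eta: "\<eta> = 1 + \<alpha> * L"
    and c2: "c2 = 2 * \<mu>bar * Lbar / (\<mu>bar + Lbar)"
    and c3: "c3 = \<alpha> * D * L / (\<eta> - 1)"
    and c5: "c5 = \<alpha> * M / (\<eta> - 1)"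
    and T: "\<And>k. T k = \<eta> ^ tg k - 1 - real (tg k) * (\<eta> - 1)"
    and c3hat: "c3hat = c3 * (\<eta> ^ tg 0 - 1)"
    and c5hat: "c5hat = c5 * T 0"
    and tau: "\<tau> = Max ((\<lambda>i. T (i + 1) / T i) ` {0..tg 0 - 1})"
    and C: "C = max (norm (xbar 0 - xstar)) (8 * (c3hat + c5hat) / (\<alpha> * c2)\<^sup>2)"
    and rho: "\<rho> = max \<beta> (max \<tau> (1 - \<alpha> * c2 / 2))"
  shows "\<rho> < 1 \<and> (\<forall>k. norm (xbar k - xstar) \<le> C * \<rho> ^ k)"
proof -
  let ?n = "real CARD('n)"
  define U where "U = stack ustar"
  define s where "s = \<alpha> * c2"
  define h where "h = \<alpha> * L"
  define fbar where "fbar z = (1 / ?n) * (\<Sum>i\<in>UNIV. f i z)" for z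
  define gbar where "gbar z = (1 / ?n) *\<^sub>R (\<Sum>i\<in>UNIV. grad i z)" for z
  define e where "e k = norm (xbar k - xstar)" for k

  \<comment> \<open>Curvature constants and contraction of the averaged objective\<close>
  have sw: "quadratic_sandwich (\<mu> i) (Lip i) (f i) (grad i)" for i
    using strong gradient lipschitz by (rule quadratic_sandwichI)
  have swbar: "quadratic_sandwich \<mu>bar Lbar fbar gbar"
    unfolding mubar Lbar fbar_def[abs_def] gbar_def[abs_def]
    by (rule quadratic_sandwich_average[OF sw]) simp
  have \<mu>L: "\<mu> i \<le> Lip i" for i using quadratic_sandwich_mono[OF sw] .
  have LipL: "Lip i \<le> L" for i unfolding L by simp
  have L0: "0 < L" using constants_pos(1) LipL less_le_trans by blast
  have mubar0: "0 < \<mu>bar" and Lbar0: "0 < Lbar"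
    unfolding mubar Lbar using constants_pos by (auto intro!: divide_pos_pos sum_pos)
  have "Lbar \<le> (1 / ?n) * (\<Sum>i\<in>(UNIV::'n set). L)"
    unfolding Lbar by (intro mult_left_mono sum_mono LipL) auto
  then have LbarL: "Lbar \<le> L" by simp
  have \<alpha>0: "0 \<le> \<alpha>" and h0: "0 < h" using steplength(1) L0 by (auto simp: h_def)
  have \<alpha>c4: "\<alpha> \<le> 2 / (\<mu>bar + Lbar)" using steplength(2) c4 by simp
  have c2pos: "0 < c2" unfolding c2 using mubar0 Lbar0 by simp
  have s0: "0 < s" using steplength(1) c2pos by (simp add: s_def)
  have s1: "s \<le> 1" unfolding s_def c2 by (rule step_rate_le_1[OF mubar0 Lbar0 \<alpha>c4])
  \<comment> \<open>\<open>c2\<close> is a harmonic mean. This crude bound gives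
    \<open>s \<le> 2 * h\<close>, which the first round needs to compare \<open>s\<^sup>2\<close>
    with \<open>T 0\<close>.\<close>
  have c2L: "c2 \<le> 2 * L"
  proof -
    have "c2 = 2 * Lbar * (\<mu>bar / (\<mu>bar + Lbar))" by (simp add: c2)
    also have "\<dots> \<le> 2 * Lbar * 1" using mubar0 Lbar0 by (intro mult_left_mono) auto
    finally show ?thesis using LbarL by simp
  qed
  then have "s \<le> \<alpha> * (2 * L)" unfolding s_def using \<alpha>0 by (rule mult_left_mono)
  then have sh: "s \<le> 2 * h" by (simp add: h_def)
  have lip: "norm (grad i a - grad i b) \<le> L * norm (a - b)" for i a b
    using lipschitz_onD[OF lipschitz[of i], of a b] mult_right_mono[OF LipL[of i], of "norm (a - b)"]
    by (simp add: dist_norm)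

  have gbar0: "gbar xstar = 0"
  proof (rule quadratic_sandwich_gradient_zero[OF swbar Lbar0])
    show "is_arg_min fbar (\<lambda>_. True) xstar"
      using xstar by (simp add: is_arg_min_def fbar_def divide_less_cancel not_less)
  qed
  have gloc0: "grad i (ustar i) = 0" for i
    by (rule quadratic_sandwich_gradient_zero[OF sw constants_pos(1) ustar])
  have contr: "norm ((z - \<alpha> *\<^sub>R gbar z) - xstar) \<le> sqrt (1 - s) * norm (z - xstar)" for z
    using real_sqrt_le_mono[OF gradient_step_contraction[OF swbar mubar0 Lbar0 \<alpha>0 \<alpha>c4, of z xstar]]
    by (simp add: gbar0 s_def c2 real_sqrt_mult)

  \<comment> \<open>Contraction of the local gradient steps\<close>
  have \<gamma>le: "\<gamma> \<le> \<gamma>loc i" for i unfolding gamma by simp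
  have "\<gamma> \<in> range \<gamma>loc" unfolding gamma by (rule Min_in) auto
  then have "0 < \<gamma>" using constants_pos by (auto simp: gamma_loc add_pos_pos)
  then have \<nu>0: "0 < \<nu>" using steplength(1) by (simp add: nu)
  \<comment> \<open>Since \<open>\<mu> i + Lip i\<close> is at most \<open>2 * L\<close>, the bound
    \<open>1 / L\<close> is admissible for every local function.\<close>
  have \<alpha>loc: "\<alpha> \<le> 2 / (\<mu> i + Lip i)" for i
  proof -
    have "\<alpha> \<le> 1 / L" using steplength(2) by simp
    also have "\<dots> \<le> 2 / (\<mu> i + Lip i)"
      using \<mu>L[of i] LipL[of i] constants_pos[of i] L0 by (simp add: frac_le_eq field_simps)
    finally show ?thesis .
  qed
  have \<nu>loc: "\<nu> \<le> \<alpha> * (2 * \<mu> i * Lip i / (\<mu> i + Lip i))" for i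
    using mult_left_mono[OF \<gamma>le[of i], of "2 * \<alpha>"] \<alpha>0 by (simp add: nu gamma_loc mult_ac)
  have \<nu>1: "\<nu> \<le> 1"
    using \<nu>loc step_rate_le_1[OF constants_pos(2,1) \<alpha>loc] order_trans by blast

  have gs: "norm (gradient_step \<alpha> grad X - U) \<le> (1 - \<nu> / 2) * norm (X - U)" for X
  proof -
    have "(norm (gradient_step \<alpha> grad X - U))\<^sup>2 \<le> (1 - \<nu>) * (norm (X - U))\<^sup>2"
      unfolding U_def
    proof (rule norm_stacked_gradient_step_le)
      fix i
      have "(norm ((block X i - \<alpha> *\<^sub>R grad i (block X i)) - ustar i))\<^sup>2
          \<le> (1 - \<alpha> * (2 * \<mu> i * Lip i / (\<mu> i + Lip i))) * (norm (block X i - ustar i))\<^sup>2"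
        using gradient_step_contraction[OF sw constants_pos(2,1) \<alpha>0 \<alpha>loc, of _ i "ustar i"]
        by (simp add: gloc0)
      also have "\<dots> \<le> (1 - \<nu>) * (norm (block X i - ustar i))\<^sup>2"
        using \<nu>loc[of i] by (intro mult_right_mono) auto
      finally show "(norm ((block X i - \<alpha> *\<^sub>R grad i (block X i)) - ustar i))\<^sup>2
          \<le> (1 - \<nu>) * (norm (block X i - ustar i))\<^sup>2" .
    qed
    \<comment> \<open>Replacing \<open>sqrt (1 - \<nu>)\<close> by \<open>1 - \<nu> / 2\<close>
      leads to the fraction \<open>4 / \<nu>\<close> in \<open>D\<close>.\<close>
    also have "\<dots> \<le> (1 - \<nu> / 2)\<^sup>2 * (norm (X - U))\<^sup>2"
      by (intro mult_right_mono) (auto simp: power2_eq_square field_simps)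
    finally have "(norm (gradient_step \<alpha> grad X - U))\<^sup>2 \<le> ((1 - \<nu> / 2) * norm (X - U))\<^sup>2"
      by (simp add: power_mult_distrib)
    then show ?thesis by (rule power2_le_imp_le) (use \<nu>1 in simp)
  qed
  \<comment> \<open>One factor is kept and the others are bounded by 1, so the recursion for
    \<open>y\<close> does not depend on the number of gradient steps.\<close>
  have gst: "norm ((gradient_step \<alpha> grad ^^ Suc t) X - U) \<le> (1 - \<nu> / 2) * norm (X - U)" for t X
  proof (induction t)
    case 0
    then show ?case using gs by simp
  next
    case (Suc t)
    have "norm ((gradient_step \<alpha> grad ^^ Suc (Suc t)) X - U)
        \<le> (1 - \<nu> / 2) * norm ((gradient_step \<alpha> grad ^^ Suc t) X - U)"
      using gs[of "(gradient_step \<alpha> grad ^^ Suc t) X"] by simp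
    also have "\<dots> \<le> 1 * norm ((gradient_step \<alpha> grad ^^ Suc t) X - U)"
      using \<nu>0 by (intro mult_right_mono) auto
    finally show ?case using Suc by simp
  qed

  \<comment> \<open>Boundedness of the iterates and decay of the disagreement\<close>
  have xSuc: "x (Suc k) = matrix_power (kronecker W (mat 1)) k *v y k" for k
    by (simp add: x y tc)
  have xbarSuc: "xbar (Suc k) = block_average (y k)" for k
    by (simp add: xbar xSuc block_average_consensus_power[OF consensus])
  have tg1: "1 \<le> tg k" for k by (simp add: tg(2)[of k])
  have yD: "norm (y k) \<le> D" for k
  proof -
    have "norm (y k - U) \<le> norm (y 0 - U) + 4 / \<nu> * norm U"
    proof (rule affine_recursion_bound[where Y = "\<lambda>k. norm (y k - U)"])
      fix k
      obtain t where t: "tg (Suc k) = Suc t" using tg1[of "Suc k"] by (cases "tg (Suc k)") auto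
      have "norm (y (Suc k) - U) \<le> (1 - \<nu> / 2) * norm (x (Suc k) - U)"
        unfolding y[of "Suc k"] t by (rule gst)
      \<comment> \<open>Consensus need not fix \<open>U\<close>, so the comparison passes through
        the origin, where the consensus power is nonexpansive, at the cost of
        \<open>2 * norm U\<close>.\<close>
      also have "norm (x (Suc k) - U) \<le> norm (y k - U) + 2 * norm U"
        using norm_triangle_ineq4[of "x (Suc k)" U] norm_triangle_sub[of "y k" U]
          norm_consensus_power_le[OF consensus, of k "y k"] by (simp add: xSuc)
      finally show "norm (y (Suc k) - U) \<le> (1 - \<nu> / 2) * (norm (y k - U) + 2 * norm U)"
        using \<nu>1 by (simp add: mult_left_mono)
    qed (use \<nu>0 \<nu>1 in auto)
    moreover have "D = norm (y 0 - U) + (norm U + 4 / \<nu> * norm U)"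
      using \<nu>0 by (simp add: D U_def field_simps)
    ultimately show ?thesis
      using norm_triangle_sub[of "y k" U] by simp
  qed
  have D0: "0 \<le> D" using yD norm_ge_zero order_trans by blast
  have eD: "e (Suc k) \<le> Dhat" for k
  proof -
    have "norm (xbar (Suc k)) \<le> D / sqrt ?n"
      using norm_block_average_le[of "y k"] divide_right_mono[OF yD[of k], of "sqrt ?n"]
      by (simp add: xbarSuc)
    then show ?thesis
      using norm_triangle_ineq4[of "xbar (Suc k)" xstar] by (simp add: e_def Dhat)
  qed
  have Dhat0: "0 \<le> Dhat" using D0 by (simp add: Dhat)
  \<comment> \<open>As \<open>tc k = k\<close>, the iterate \<open>x (Suc k)\<close> is
    \<open>y k\<close> after \<open>k\<close> consensus multiplications; hence the lag of one in the
    exponent.\<close>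
  have dev: "norm (x (Suc k) - stack (\<lambda>_. block_average (x (Suc k)))) \<le> \<beta> ^ k * D" for k
  proof -
    have "norm (x (Suc k) - stack (\<lambda>_. block_average (x (Suc k)))) \<le> \<beta> ^ k * norm (y k)"
      using norm_consensus_power_disagreement_le[OF consensus graph beta(1), of k "y k"]
      by (simp add: xSuc block_average_consensus_power[OF consensus])
    also have "\<dots> \<le> \<beta> ^ k * D" using beta(2) by (intro mult_left_mono yD) auto
    finally show ?thesis .
  qed

  \<comment> \<open>\<open>d\<close> and \<open>R\<close> stay free: round 0 can use exact consensus
    and \<open>e 0\<close>, while later rounds use \<open>dev\<close> and
    \<open>Dhat\<close>.\<close>
  have step: "e (Suc k) \<le> sqrt (1 - s) * e k + d * ((1 + h) ^ tg k - 1)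
      + (2 * L * R + (\<Sum>i\<in>UNIV. norm (grad i xstar))) / L * power_excess h (tg k)"
    if "norm (x k - stack (\<lambda>_. block_average (x k))) \<le> d" and "e k \<le> R" for k d R
    using averaged_gradient_steps_error[where g = grad and X = "x k" and xs = xstar
        and q = "sqrt (1 - s)" and \<alpha> = \<alpha> and L = L and R = R and d = d and t = "tg k"]
      contr gbar0 \<alpha>0 L0 lip that tg1 s0 s1
    by (simp add: gbar_def e_def xbar xbarSuc[unfolded xbar] y h_def)

  \<comment> \<open>The excess terms and the rate\<close>
  have Tk: "T k = power_excess h (tg k)" for k
    by (simp add: T eta power_excess_def h_def)
  have T0: "0 \<le> T k" for k using power_excess_nonneg h0 by (simp add: Tk)
  have c3': "c3 = D" using steplength(1) L0 by (simp add: c3 eta)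
  have c5': "c5 = M / L" using steplength(1) L0 by (simp add: c5 eta)
  have M0: "0 \<le> M" unfolding M using L0 Dhat0 by (intro add_nonneg_nonneg sum_nonneg) auto
  have c30: "0 \<le> c3hat" using D0 h0 by (simp add: c3hat c3' eta h_def one_le_power)
  have c50: "0 \<le> c5hat" using M0 L0 T0 by (simp add: c5hat c5')
  have tgSuc: "tg k = Suc 0 \<and> tg (Suc k) = Suc 0 \<or> k < tg 0 - 1 \<and> 1 \<le> tg (Suc k) \<and> tg k = Suc (tg (Suc k))" for k
    using tg(1) tg(2)[of k] tg(2)[of "Suc k"] by auto
  have \<tau>1: "\<tau> < 1"
  proof -
    have "T (i + 1) / T i < 1" for i
    proof (cases "tg i = Suc 0")
      case True
      \<comment> \<open>Here \<open>T i = 0\<close>, and division by zero yields 0, matching the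
        convention 0/0 = 0.\<close>
      then show ?thesis by (simp add: Tk)
    next
      case False
      then have "T (i + 1) < T i"
        using tgSuc[of i] power_excess_less_Suc[OF h0, of "tg (Suc i)"] by (simp add: Tk)
      then show ?thesis using T0[of "i + 1"] by simp
    qed
    then show ?thesis unfolding tau by (subst Max_less_iff) auto
  qed
  have \<rho>1: "\<rho> < 1" using beta(3) \<tau>1 s0 by (simp add: rho s_def)
  have \<rho>r: "1 - s / 2 \<le> \<rho>" and \<rho>\<beta>: "\<beta> \<le> \<rho>" and \<rho>\<tau>: "\<tau> \<le> \<rho>" by (simp_all add: rho s_def)
  have \<rho>half: "1 / 2 \<le> \<rho>" using \<rho>r s1 by simp
  have Tdecay: "T k \<le> \<rho> ^ k * T 0" for k
  proof (induction k)
    case 0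
    then show ?case by simp
  next
    case (Suc k)
    have "T (Suc k) \<le> \<rho> * T k"
    proof (cases "tg k = Suc 0")
      case True
      then show ?thesis using tgSuc[of k] by (auto simp: Tk)
    next
      case False
      then have k: "k < tg 0 - 1" "T (Suc k) < T k"
        using tgSuc[of k] power_excess_less_Suc[OF h0, of "tg (Suc k)"] by (auto simp: Tk)
      then have "T (k + 1) / T k \<le> \<tau>" unfolding tau by (intro Max_ge imageI) auto
      then have "T (Suc k) / T k \<le> \<rho>" using \<rho>\<tau> by simp
      then show ?thesis using k T0[of "Suc k"] by (simp add: divide_le_eq split: if_splits)
    qed
    also have "\<dots> \<le> \<rho> * (\<rho> ^ k * T 0)" using Suc \<rho>half by (intro mult_left_mono) auto
    finally show ?case by simp
  qed

  \<comment> \<open>The error recursion and its first step\<close>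
  have late: "e (Suc k) \<le> sqrt (1 - s) * e k + (c3hat + c5hat) * \<rho> ^ (k - 1)" if k: "1 \<le> k" for k
  proof -
    obtain l where l: "k = Suc l" using k by (cases k) auto
    have "e (Suc k) \<le> sqrt (1 - s) * e k + \<beta> ^ l * D * ((1 + h) ^ tg k - 1) + c5 * T k"
      using step[OF dev[of l] eD[of l]] by (simp add: l c5' M Tk)
    also have "\<beta> ^ l * D * ((1 + h) ^ tg k - 1) \<le> \<rho> ^ l * D * ((1 + h) ^ tg 0 - 1)"
    proof (intro mult_mono power_mono)
      show "(1 + h) ^ tg k - 1 \<le> (1 + h) ^ tg 0 - 1"
        using h0 tg(1) tg(2)[of k] by (intro diff_mono power_increasing) auto
    qed (use \<rho>\<beta> beta(2) D0 h0 \<rho>half in \<open>auto simp: one_le_power\<close>)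
    also have "\<rho> ^ l * D * ((1 + h) ^ tg 0 - 1) = c3hat * \<rho> ^ l"
      by (simp add: c3hat c3' eta h_def)
    also have "c5 * T k \<le> c5hat * \<rho> ^ l"
    proof -
      \<comment> \<open>One power of \<open>\<rho>\<close> is given away so that this term shares
        the exponent of the lagging disagreement term.\<close>
      have "\<rho> ^ k * T 0 \<le> \<rho> ^ l * T 0"
        using \<rho>1 \<rho>half T0 l by (intro mult_right_mono power_decreasing) auto
      then have "c5 * T k \<le> c5 * (\<rho> ^ l * T 0)"
        using Tdecay[of k] M0 L0 by (intro mult_left_mono) (auto simp: c5')
      then show ?thesis by (simp add: c5hat mult_ac)
    qed
    finally show ?thesis by (simp add: l algebra_simps)
  qed
  have C0: "e 0 \<le> C" and C1: "8 * (c3hat + c5hat) / s\<^sup>2 \<le> C" by (simp_all add: C e_def s_def)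
  text \<open>The bound \<open>Dhat\<close> need not hold for \<open>e 0\<close>, since \<open>D\<close> does not involve \<open>x 0\<close>.\<close>
  have first: "e 1 \<le> C * \<rho>"
  proof (cases "tg 0 = 1")
    case True
    \<comment> \<open>With one gradient step from exact consensus, both perturbations vanish:
      \<open>d = 0\<close> and the excess at 1 is 0.\<close>
    have "e (Suc 0) \<le> sqrt (1 - s) * e 0"
      using step[of 0 0 "e 0"] True by (simp add: x)
    also have "\<dots> \<le> \<rho> * C"
    proof (intro mult_mono C0)
      have "sqrt (1 - s) \<le> 1 - s / 2"
        by (rule real_le_lsqrt) (use s0 s1 in \<open>auto simp: power2_eq_square field_simps\<close>)
      then show "sqrt (1 - s) \<le> \<rho>" using \<rho>r by linarith
    qed (use \<rho>half in \<open>auto simp: e_def\<close>)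
    finally show ?thesis by (simp add: mult.commute)
  next
    case False
    \<comment> \<open>Now \<open>tg 0\<close> is at least 2, so \<open>T 0\<close> is at least
      \<open>s\<^sup>2 / 4\<close>. With \<open>c5\<close> at least \<open>2 * Dhat\<close> this
      gives \<open>4 * Dhat \<le> C\<close>, and \<open>\<rho>\<close> being at least 1/2 leaves
      enough room for \<open>e 1 \<le> Dhat\<close>.\<close>
    then have "h\<^sup>2 \<le> T 0" unfolding Tk using tg(1) h0 by (intro power_excess_ge_square) auto
    moreover have "s\<^sup>2 \<le> (2 * h)\<^sup>2" using s0 sh by (intro power_mono) auto
    ultimately have "s\<^sup>2 / 4 \<le> T 0" by (simp add: power_mult_distrib)
    moreover have "2 * Dhat \<le> c5"
      using L0 by (simp add: c5' M le_divide_eq sum_nonneg)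
    ultimately have "2 * Dhat * (s\<^sup>2 / 4) \<le> c5hat"
      unfolding c5hat using Dhat0 by (intro mult_mono) auto
    then have "4 * Dhat * s\<^sup>2 \<le> 8 * (c3hat + c5hat)" using c30 by simp
    then have "4 * Dhat \<le> 8 * (c3hat + c5hat) / s\<^sup>2" using s0 by (simp add: le_divide_eq)
    then have "4 * Dhat * (1 / 2) \<le> C * \<rho>" using C1 \<rho>half Dhat0 by (intro mult_mono) auto
    then show ?thesis using eD[of 0] Dhat0 by simp
  qed
  have "e k \<le> C * \<rho> ^ k" for k
    by (rule perturbed_linear_rate[OF s0 s1 \<rho>r C0 first late _ C1]) (use c30 c50 in auto)
  then show ?thesis using \<rho>1 by (simp add: e_def)
qed

end
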